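(* Let $I\subset R=K[x_1,\ldots,x_n]$ be a square-free monomial ideal and let $\mathfrak{m}=(x_1,\ldots,x_n)$. Suppose that there exists some $m\ge 1$ such that $\mathrm{Ass}(I^s)=\mathrm{Min}(I)$ for all $1\le s\le m$, and such that for all $s\ge m+1$ one has $\mathrm{Ass}(I^s)=\mathrm{Min}(I)\cup\{\mathfrak{m}\}$ and $\mathfrak{m}\setminus x_j\notin\mathrm{Ass}(I^s\setminus x_j)$ for all $j=1,\ldots,n$. Then $I$ is minimally not normally torsion-free. In particular, $m\ge\beta_1(I)$, where $\beta_1(I)$ denotes the maximum cardinality of an independent set in $I$.
   Context: $R=K[x_1,\ldots,x_n]$ is a polynomial ring over a field $K$. For an ideal $J$, $\mathrm{Ass}(J)$ denotes the set of associated primes of the quotient of the ambient polynomial ring by $J$, and $\mathrm{Min}(J)$ the set of minimal primes of $J$. An ideal $J$ of a ring $S$ is normally torsion-free if $\mathrm{Ass}_S(S/J^k)\subseteq\mathrm{Ass}_S(S/J)$ for all $k\ge 1$. $\mathcal{G}(J)$ denotes the unique minimal set of monomial generators of a monomial ideal $J$. The contraction $J/x_j$ is obtained by setting $x_j=1$ in each $u\in\mathcal{G}(J)$, and the deletion $J\setminus x_j$ is obtained by setting $x_j=0$ in each $u\in\mathcal{G}(J)$; both are regarded as ideals in the polynomial ring $K[x_i : i\ne j]$. In particular $\mathfrak{m}\setminus x_j$ is the ideal of $K[x_i: i\neq j]$ generated by all its variables. A minor of a square-free monomial ideal $I$ is an ideal obtained from $I$ by a sequence of deletions and contractions in any order.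 $I$ is minimally not normally torsion-free if $I$ is not normally torsion-free but all its proper minors are normally torsion-free. A set $\Gamma\subseteq\mathcal{G}(I)$ is an independent set in $I$ if $\gcd(f,g)=1$ for all $f,g\in\Gamma$ with $f\ne g$. *)

theory Defs
  imports
    "HOL-Library.Poly_Mapping"
    "HOL-Algebra.Ideal_Product"
    "HOL-Algebra.QuotRing"
    "HOL-Algebra.Divisibility"
begin

section \<open>Polynomial rings on varying sets of variables\<close>

text \<open>
  All polynomials live in the type \<open>(nat \<Rightarrow>\<^sub>0 nat) \<Rightarrow>\<^sub>0 'k\<close> (finitely supported maps from
  exponent vectors to coefficients), which has a variable \<open>x\<^sub>i\<close> for every natural
  number \<open>i\<close>.  Deletions and contractions change the ambient ring, so the ring
  \<open>K[x\<^sub>i : i \<in> V]\<close> is the explicit subring of polynomials involving only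
  variables with index in \<open>V\<close>; ideals, primes and quotients are always taken in that ring.
\<close>

type_synonym 'k mpoly = "(nat \<Rightarrow>\<^sub>0 nat) \<Rightarrow>\<^sub>0 'k"

definition poly_ring :: "nat set \<Rightarrow> 'k::field mpoly ring" where
  "poly_ring V =
     \<lparr>carrier = {p. \<forall>t \<in> Poly_Mapping.keys p. Poly_Mapping.keys t \<subseteq> V},
      monoid.mult = (*), one = 1, zero = 0, add = (+)\<rparr>"

lemma poly_ring_cring: "cring (poly_ring V :: 'k::field mpoly ring)"
proof (rule cringI)
  let ?R = "poly_ring V :: 'k mpoly ring"
  have uminus: "- p \<in> carrier ?R" if "p \<in> carrier ?R" for p
    using that by (simp add: poly_ring_def)
  have add: "p + q \<in> carrier ?R" if "p \<in> carrier ?R" "q \<in> carrier ?R" for p q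
    using that Poly_Mapping.keys_add[of p q] unfolding poly_ring_def by fastforce
  have mult: "p * q \<in> carrier ?R" if "p \<in> carrier ?R" "q \<in> carrier ?R" for p q
  proof -
    have "Poly_Mapping.keys t \<subseteq> V" if t: "t \<in> Poly_Mapping.keys (p * q)" for t
    proof -
      obtain a b where "t = a + b" "a \<in> Poly_Mapping.keys p" "b \<in> Poly_Mapping.keys q"
        using t keys_mult[of p q] by blast
      with \<open>p \<in> carrier ?R\<close> \<open>q \<in> carrier ?R\<close> Poly_Mapping.keys_add[of a b]
      show ?thesis unfolding poly_ring_def by fastforce
    qed
    then show ?thesis by (simp add: poly_ring_def)
  qed
  show "abelian_group ?R"
  proof (rule abelian_groupI)
    show "\<exists>y \<in> carrier ?R. y \<oplus>\<^bsub>?R\<^esub> x = \<zero>\<^bsub>?R\<^esub>" if "x \<in> carrier ?R" for x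
      using uminus[OF that] by (intro bexI[of _ "- x"]) (simp_all add: poly_ring_def)
    show "x \<oplus>\<^bsub>?R\<^esub> y \<in> carrier ?R" if "x \<in> carrier ?R" "y \<in> carrier ?R" for x y
      using add[OF that] by (simp add: poly_ring_def)
  qed (simp_all add: poly_ring_def ac_simps)
  show "comm_monoid ?R"
  proof (rule comm_monoidI)
    show "x \<otimes>\<^bsub>?R\<^esub> y \<in> carrier ?R" if "x \<in> carrier ?R" "y \<in> carrier ?R" for x y
      using mult[OF that] by (simp add: poly_ring_def)
  qed (simp_all add: poly_ring_def ac_simps)
  show "(x \<oplus>\<^bsub>?R\<^esub> y) \<otimes>\<^bsub>?R\<^esub> z = x \<otimes>\<^bsub>?R\<^esub> z \<oplus>\<^bsub>?R\<^esub> y \<otimes>\<^bsub>?R\<^esub> z" for x y z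
    by (simp add: poly_ring_def distrib_right)
qed

definition pvar :: "nat \<Rightarrow> 'k::field mpoly" where
  "pvar i = Poly_Mapping.single (Poly_Mapping.single i 1) 1"

definition irrelevant_ideal :: "nat set \<Rightarrow> 'k::field mpoly set" where
  "irrelevant_ideal V = Idl\<^bsub>poly_ring V\<^esub> (pvar ` V)"

section \<open>Associated and minimal primes\<close>

text \<open>
  \<open>Ass(R/J)\<close>: the primes of \<open>R\<close> that are annihilators of elements \<open>a\<close> of the module \<open>R/J\<close>.
  The scalar action of \<open>r\<close> on \<open>R/J\<close> is multiplication by the class \<open>J +> r\<close>.
\<close>

definition Ass :: "('a, 'b) ring_scheme \<Rightarrow> 'a set \<Rightarrow> 'a set set" where
  "Ass R J = {P. primeideal P R \<and>
     (\<exists>a \<in> carrier (R Quot J).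
        P = {r \<in> carrier R. (J +>\<^bsub>R\<^esub> r) \<otimes>\<^bsub>R Quot J\<^esub> a = \<zero>\<^bsub>R Quot J\<^esub>})}"

definition Min_primes :: "('a, 'b) ring_scheme \<Rightarrow> 'a set \<Rightarrow> 'a set set" where
  "Min_primes R J = {P. primeideal P R \<and> J \<subseteq> P \<and>
     (\<forall>Q. primeideal Q R \<and> J \<subseteq> Q \<and> Q \<subseteq> P \<longrightarrow> Q = P)}"

definition ideal_power :: "('a, 'b) ring_scheme \<Rightarrow> 'a set \<Rightarrow> nat \<Rightarrow> 'a set" where
  "ideal_power R J k = J [^]\<^bsub>ideals_set R\<^esub> k"

definition normally_torsion_free :: "('a, 'b) ring_scheme \<Rightarrow> 'a set \<Rightarrow> bool" where
  "normally_torsion_free R J \<longleftrightarrow> (\<forall>k::nat. k \<ge> 1 \<longrightarrow> Ass R (ideal_power R J k) \<subseteq> Ass R J)"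

section \<open>Monomial ideals and their minors\<close>

definition monomials :: "nat set \<Rightarrow> 'k::field mpoly set" where
  "monomials V = {Poly_Mapping.single t 1 | t. Poly_Mapping.keys t \<subseteq> V}"

definition squarefree_monomials :: "nat set \<Rightarrow> 'k::field mpoly set" where
  "squarefree_monomials V =
     {Poly_Mapping.single t 1 | t.
        Poly_Mapping.keys t \<subseteq> V \<and> (\<forall>i. Poly_Mapping.lookup t i \<le> 1)}"

definition squarefree_monomial_ideal :: "nat set \<Rightarrow> 'k::field mpoly set \<Rightarrow> bool" where
  "squarefree_monomial_ideal V J \<longleftrightarrow>
     (\<exists>S \<subseteq> squarefree_monomials V. J = Idl\<^bsub>poly_ring V\<^esub> S)"

text \<open>
  The set \<open>\<G>(J)\<close> of monomial generators, minimal with respect to inclusion. It exists and is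
  unique for every monomial ideal; the definition is only meaningful for such ideals.
\<close>

definition min_gens :: "nat set \<Rightarrow> 'k::field mpoly set \<Rightarrow> 'k mpoly set" where
  "min_gens V J =
     (THE G. G \<subseteq> monomials V \<and> Idl\<^bsub>poly_ring V\<^esub> G = J \<and>
             (\<forall>H. H \<subset> G \<longrightarrow> Idl\<^bsub>poly_ring V\<^esub> H \<noteq> J))"

text \<open>
  The substitution \<open>x\<^sub>j := c\<close>: a term \<open>a x\<^sup>t\<close> becomes \<open>a c\<^sup>e x\<^sup>u\<close>, where \<open>e\<close> is the
  exponent of \<open>x\<^sub>j\<close> in \<open>t\<close>, and \<open>u\<close> is \<open>t\<close> with that exponent reset to 0.
\<close>

definition subst_var :: "nat \<Rightarrow> 'k::field \<Rightarrow> 'k mpoly \<Rightarrow> 'k mpoly" where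
  "subst_var j c p =
     (\<Sum>t \<in> Poly_Mapping.keys p.
        Poly_Mapping.single (Poly_Mapping.update j 0 t)
          (Poly_Mapping.lookup p t * c ^ Poly_Mapping.lookup t j))"

text \<open>
  The argument \<open>V\<close> indexes the variables of the ring containing \<open>J\<close>; the result is an ideal of
  the polynomial ring on \<open>V - {j}\<close>.
\<close>

definition deletion :: "nat set \<Rightarrow> nat \<Rightarrow> 'k::field mpoly set \<Rightarrow> 'k mpoly set" where
  "deletion V j J = Idl\<^bsub>poly_ring (V - {j})\<^esub> (subst_var j 0 ` min_gens V J)"

definition contraction :: "nat set \<Rightarrow> nat \<Rightarrow> 'k::field mpoly set \<Rightarrow> 'k mpoly set" where
  "contraction V j J = Idl\<^bsub>poly_ring (V - {j})\<^esub> (subst_var j 1 ` min_gens V J)"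

text \<open>
  An ideal is carried along with the index set of its ambient ring. Proper minors are those
  obtained by at least one deletion or contraction, i.e. those with a strictly smaller index set.
\<close>

inductive minor_step ::
  "nat set \<times> 'k::field mpoly set \<Rightarrow> nat set \<times> 'k mpoly set \<Rightarrow> bool" where
  delete: "j \<in> V \<Longrightarrow> minor_step (V, J) (V - {j}, deletion V j J)"
| contract: "j \<in> V \<Longrightarrow> minor_step (V, J) (V - {j}, contraction V j J)"

definition minimally_not_ntf :: "nat set \<Rightarrow> 'k::field mpoly set \<Rightarrow> bool" where
  "minimally_not_ntf V J \<longleftrightarrow>
     \<not> normally_torsion_free (poly_ring V) J \<and>
     (\<forall>W L. minor_step\<^sup>+\<^sup>+ (V, J) (W, L) \<longrightarrow> normally_torsion_free (poly_ring W) L)"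

definition independent_set :: "nat set \<Rightarrow> 'k::field mpoly set \<Rightarrow> 'k mpoly set \<Rightarrow> bool" where
  "independent_set V J \<Gamma> \<longleftrightarrow>
     \<Gamma> \<subseteq> min_gens V J \<and>
     (\<forall>f\<in>\<Gamma>. \<forall>g\<in>\<Gamma>. f \<noteq> g \<longrightarrow> \<one>\<^bsub>poly_ring V\<^esub> gcdof\<^bsub>poly_ring V\<^esub> f g)"

definition beta1 :: "nat set \<Rightarrow> 'k::field mpoly set \<Rightarrow> nat" where
  "beta1 V J = Max {card \<Gamma> | \<Gamma>. independent_set V J \<Gamma>}"

end

theory Submission
  imports Defs
begin

text \<open>
  A monomial prime is associated to a monomial ideal exactly when it is the annihilator of a
  monomial, and a square-free monomial ideal is normally torsion-free exactly when all its powers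
  equal its symbolic powers; the latter condition concerns exponent vectors and vertex covers only
  and passes to deletions and contractions. Contracting at \<open>x\<^sub>k\<close> keeps only associated primes of
  \<open>I\<^sup>s\<close> that avoid \<open>x\<^sub>k\<close>, which by hypothesis are minimal. An associated prime of
  \<open>(I \<setminus> x\<^sub>j)\<^sup>s\<close> other than the maximal one avoids some \<open>x\<^sub>k\<close>, so it is controlled by the
  contraction at \<open>x\<^sub>k\<close>; the maximal one is excluded by hypothesis for \<open>s > m\<close>. For the bound on
  \<open>m\<close>, a monomial in the socle of \<open>R/I\<^sup>m\<^sup>+\<^sup>1\<close> is divisible by every variable, hence by the product
  of any independent set, which therefore has at most \<open>m\<close> elements.
\<close>

section \<open>Exponent vectors and vertex covers\<close>

abbreviation "lookup \<equiv> Poly_Mapping.lookup"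
abbreviation "keys \<equiv> Poly_Mapping.keys"
abbreviation "single \<equiv> Poly_Mapping.single"

definition evar :: "nat \<Rightarrow> nat \<Rightarrow>\<^sub>0 nat" where
  "evar i = single i 1"

lemma lookup_evar [simp]: "lookup (evar i) k = (if k = i then 1 else 0)"
  by (simp add: evar_def lookup_single when_def)

lemma keys_evar [simp]: "keys (evar i) = {i}"
  by (simp add: evar_def)

text \<open>Not restricted to a set of variables, so that one set serves every ambient ring;
  \<open>mideal\<close> adds the restriction.\<close>

definition multiples :: "(nat \<Rightarrow>\<^sub>0 nat) set \<Rightarrow> (nat \<Rightarrow>\<^sub>0 nat) set" where
  "multiples T = {t. \<exists>g\<in>T. \<forall>i. lookup g i \<le> lookup t i}"

text \<open>The order of \<open>x^t\<close> along the prime generated by the variables in a finite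
  set \<open>C\<close>: the monomial lies in the \<open>s\<close>-th power of that prime iff
  \<open>s \<le> wdeg C t\<close>.\<close>

definition wdeg :: "nat set \<Rightarrow> (nat \<Rightarrow>\<^sub>0 nat) \<Rightarrow> nat" where
  "wdeg C t = (\<Sum>i\<in>C. lookup t i)"

fun ksum :: "(nat \<Rightarrow>\<^sub>0 nat) set \<Rightarrow> nat \<Rightarrow> (nat \<Rightarrow>\<^sub>0 nat) set" where
  "ksum T 0 = {0}"
| "ksum T (Suc k) = {a + b |a b. a \<in> ksum T k \<and> b \<in> T}"

definition squarefree_exps :: "nat set \<Rightarrow> (nat \<Rightarrow>\<^sub>0 nat) set \<Rightarrow> bool" where
  "squarefree_exps V T \<longleftrightarrow> (\<forall>t\<in>T. keys t \<subseteq> V \<and> (\<forall>i. lookup t i \<le> 1))"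

definition cover :: "(nat \<Rightarrow>\<^sub>0 nat) set \<Rightarrow> nat set \<Rightarrow> bool" where
  "cover T C \<longleftrightarrow> (\<forall>g\<in>T. \<exists>i\<in>C. lookup g i > 0)"

definition min_cover :: "nat set \<Rightarrow> (nat \<Rightarrow>\<^sub>0 nat) set \<Rightarrow> nat set \<Rightarrow> bool" where
  "min_cover V T A \<longleftrightarrow> A \<subseteq> V \<and> cover T A \<and> (\<forall>B. B \<subset> A \<longrightarrow> \<not> cover T B)"

text \<open>
  \<open>A\<close> indexes the variables of a monomial prime that is the annihilator of \<open>x\<^sup>u\<close> modulo the
  monomial ideal with generator exponents \<open>T\<close>.
\<close>

definition assoc_at :: "nat set \<Rightarrow> (nat \<Rightarrow>\<^sub>0 nat) set \<Rightarrow> nat set \<Rightarrow> (nat \<Rightarrow>\<^sub>0 nat) \<Rightarrow> bool" where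
  "assoc_at V T A u \<longleftrightarrow> A \<subseteq> V \<and> keys u \<subseteq> V \<and> (\<forall>i\<in>A. u + evar i \<in> multiples T) \<and>
     (\<forall>r. keys r \<subseteq> V - A \<longrightarrow> u + r \<notin> multiples T)"

text \<open>
  The \<open>s\<close>-th ordinary power of the square-free ideal generated by \<open>T\<close> equals its \<open>s\<close>-th
  symbolic power, the intersection of the \<open>s\<close>-th powers of the primes given by the covers.
\<close>

definition powers_agree :: "nat set \<Rightarrow> (nat \<Rightarrow>\<^sub>0 nat) set \<Rightarrow> nat \<Rightarrow> bool" where
  "powers_agree V T s \<longleftrightarrow> (\<forall>t. keys t \<subseteq> V \<longrightarrow> (\<forall>C\<subseteq>V. cover T C \<longrightarrow> s \<le> wdeg C t) \<longrightarrow>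
     t \<in> multiples (ksum T s))"

section \<open>Divisibility, weights and sums of generators\<close>

lemma multiplesI: "g \<in> T \<Longrightarrow> (\<And>i. lookup g i \<le> lookup t i) \<Longrightarrow> t \<in> multiples T"
  by (auto simp: multiples_def)

lemma multiples_mono: "t \<in> multiples T \<Longrightarrow> (\<And>i. lookup t i \<le> lookup t' i) \<Longrightarrow> t' \<in> multiples T"
  unfolding multiples_def by (blast intro: order_trans)

lemma subset_multiples: "T \<subseteq> multiples T"
  by (auto simp: multiples_def)

lemma multiples_subset: "T \<subseteq> multiples U \<Longrightarrow> multiples T \<subseteq> multiples U"
  using multiples_mono unfolding multiples_def by blast

lemma keys_add_nat: "keys (a + b :: nat \<Rightarrow>\<^sub>0 nat) = keys a \<union> keys b"
  by (auto simp: in_keys_iff lookup_add)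

lemma lookup_eq_0_outside: "keys t \<subseteq> V \<Longrightarrow> i \<notin> V \<Longrightarrow> lookup t i = 0"
  by (auto simp: in_keys_iff)

lemma wdeg_add: "wdeg C (a + b) = wdeg C a + wdeg C b"
  by (simp add: wdeg_def lookup_add sum.distrib)

lemma wdeg_mono: "(\<And>i. i \<in> C \<Longrightarrow> lookup a i \<le> lookup b i) \<Longrightarrow> wdeg C a \<le> wdeg C b"
  unfolding wdeg_def by (rule sum_mono)

lemma wdeg_pos: "finite C \<Longrightarrow> wdeg C t > 0 \<longleftrightarrow> (\<exists>i\<in>C. lookup t i > 0)"
  unfolding wdeg_def by (metis gr0I gr_zeroI less_irrefl sum_eq_0_iff)

text \<open>Each of the \<open>s\<close> summands meets the cover and adds at least one to the
  weight: ordinary powers lie in symbolic powers.\<close>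

lemma wdeg_ksum:
  assumes "finite C" "cover T C" "t \<in> ksum T s"
  shows "s \<le> wdeg C t"
  using assms(3)
proof (induction s arbitrary: t)
  case (Suc s)
  then obtain a b where ab: "t = a + b" "a \<in> ksum T s" "b \<in> T" by auto
  have "wdeg C b > 0" using ab(3) assms unfolding wdeg_pos[OF assms(1)] cover_def by blast
  then show ?case using Suc.IH[OF ab(2)] by (simp add: ab(1) wdeg_add)
qed simp

lemma wdeg_multiples_ksum:
  assumes "finite C" "cover T C" "t \<in> multiples (ksum T s)"
  shows "s \<le> wdeg C t"
proof -
  obtain g where g: "g \<in> ksum T s" "\<And>i. lookup g i \<le> lookup t i"
    using assms(3) by (auto simp: multiples_def)
  then show ?thesis using wdeg_ksum[OF assms(1,2) g(1)] wdeg_mono[of C g t] by simp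
qed

lemma ksum_keys: "\<forall>t\<in>T. keys t \<subseteq> V \<Longrightarrow> \<forall>t\<in>ksum T s. keys t \<subseteq> V"
  by (induction s) (auto simp: keys_add_nat; blast)+

text \<open>Square-free summands contribute at most one each. Hence the factor \<open>x_k^s\<close>
  suffices to undo setting \<open>x_k = 1\<close> in the \<open>s\<close>-th power.\<close>

lemma ksum_lookup_le:
  "squarefree_exps V T \<Longrightarrow> t \<in> ksum T s \<Longrightarrow> lookup t i \<le> s"
proof (induction s arbitrary: t)
  case (Suc s)
  then obtain a b where ab: "t = a + b" "a \<in> ksum T s" "b \<in> T" by auto
  then show ?case using Suc.IH[of a] Suc.prems(1)
    by (auto simp: squarefree_exps_def lookup_add intro: add_le_mono[where ?j = s and ?l = 1, simplified])
qed simp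

text \<open>The witness is the \<open>s\<close>-fold sum of \<open>e\<close>, a pure power of one
  generator.\<close>

lemma ksum_keys_subset: "e \<in> T \<Longrightarrow> \<exists>r\<in>ksum T s. keys r \<subseteq> keys e"
proof (induction s)
  case (Suc s)
  then obtain r where "r \<in> ksum T s" "keys r \<subseteq> keys e" by auto
  then show ?case using Suc.prems
    by (intro bexI[of _ "r + e"]) (auto simp: keys_add_nat)
qed simp

text \<open>Exponents do not cancel, so a sum avoids \<open>j\<close> iff all its summands do:
  deletion commutes with powers.\<close>

lemma ksum_nolookup:
  "{t \<in> ksum T s. lookup t j = 0} = ksum {t \<in> T. lookup t j = 0} s"
proof (induction s)
  case (Suc s)
  have "{t \<in> ksum T (Suc s). lookup t j = 0} =
      {a + b |a b. a \<in> {t \<in> ksum T s. lookup t j = 0} \<and> b \<in> {t \<in> T. lookup t j = 0}}"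
    by (auto simp: lookup_add) blast
  then show ?case by (simp add: Suc)
qed auto

section \<open>Setting a variable to one, on exponents\<close>

lemma lookup_reset: "lookup (Poly_Mapping.update j 0 t) i = (if i = j then 0 else lookup t i)"
  by (simp add: lookup_update)

lemma keys_reset: "keys (Poly_Mapping.update j 0 t) = keys t - {j}"
  by (auto simp: in_keys_iff lookup_reset split: if_splits)

lemma reset_add:
  "Poly_Mapping.update j 0 (a + b :: nat \<Rightarrow>\<^sub>0 nat) = Poly_Mapping.update j 0 a + Poly_Mapping.update j 0 b"
  by (rule poly_mapping_eqI) (simp add: lookup_reset lookup_add)

lemma reset_zero: "Poly_Mapping.update j 0 (0 :: nat \<Rightarrow>\<^sub>0 nat) = 0"
  by (rule poly_mapping_eqI) (simp add: lookup_reset)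

lemma ksum_reset: "ksum (Poly_Mapping.update j 0 ` T) s = Poly_Mapping.update j 0 ` ksum T s"
proof (induction s)
  case (Suc s)
  then show ?case by (auto simp: reset_add image_iff) (metis reset_add)+
qed (simp add: reset_zero)

text \<open>Clearing denominators: the generator that witnesses membership after
  \<open>x_j = 1\<close> has exponent at most \<open>s\<close> at \<open>j\<close>, which the factor
  \<open>x_j^s\<close> supplies.\<close>

lemma multiples_reset:
  assumes "\<And>g. g \<in> T \<Longrightarrow> lookup g j \<le> s" and "t \<in> multiples (Poly_Mapping.update j 0 ` T)"
  shows "t + single j s \<in> multiples T"
proof -
  obtain g where g: "g \<in> T" "\<And>i. lookup (Poly_Mapping.update j 0 g) i \<le> lookup t i"
    using assms(2) by (auto simp: multiples_def)
  have "lookup g i \<le> lookup (t + single j s) i" for i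
    using assms(1)[OF g(1)] g(2)[of i]
    by (auto simp: lookup_add lookup_single lookup_reset split: if_splits)
  then show ?thesis using g(1) by (rule multiplesI[rotated])
qed

lemma multiples_imp_reset:
  assumes "t \<in> multiples T" "\<And>i. i \<noteq> j \<Longrightarrow> lookup t i \<le> lookup t' i"
  shows "t' \<in> multiples (Poly_Mapping.update j 0 ` T)"
proof -
  obtain g where g: "g \<in> T" "\<And>i. lookup g i \<le> lookup t i"
    using assms by (auto simp: multiples_def)
  then have "lookup (Poly_Mapping.update j 0 g) i \<le> lookup t' i" for i
    using order_trans[OF g(2)[of i] assms(2)[of i]] by (simp add: lookup_reset)
  then show ?thesis using g(1) by (auto intro: multiplesI)
qed

section \<open>Minimal covers and monomial witnesses\<close>

lemma exists_min_cover:
  assumes "finite C" "C \<subseteq> V" "cover T C"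
  obtains A where "A \<subseteq> C" "min_cover V T A"
proof -
  have "\<exists>A\<subseteq>C. min_cover V T A" using assms
  proof (induction rule: finite_psubset_induct)
    case (psubset C)
    show ?case
    proof (cases "min_cover V T C")
      case False
      then obtain B where "B \<subset> C" "cover T B" using psubset.prems by (auto simp: min_cover_def)
      then show ?thesis using psubset.IH[of B] psubset.prems by blast
    qed blast
  qed
  then show ?thesis using that by blast
qed

text \<open>Removing \<open>i\<close> leaves some generator \<open>e\<close> uncovered; since
  \<open>A\<close> covers it, \<open>e\<close> meets \<open>A\<close> in \<open>i\<close>
  alone.\<close>

lemma min_cover_private:
  assumes "min_cover V T A" "i \<in> A"
  obtains e where "e \<in> T" "lookup e i > 0" "\<And>k. k \<in> A \<Longrightarrow> k \<noteq> i \<Longrightarrow> lookup e k = 0"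
proof -
  have "\<not> cover T (A - {i})" using assms unfolding min_cover_def by blast
  then obtain e where e: "e \<in> T" "\<And>k. k \<in> A - {i} \<Longrightarrow> lookup e k = 0"
    by (auto simp: cover_def)
  moreover have "lookup e i > 0"
  proof -
    obtain k where "k \<in> A" "lookup e k > 0"
      using assms e(1) unfolding min_cover_def cover_def by blast
    then show ?thesis using e(2)[of k] by (cases "k = i") auto
  qed
  ultimately show ?thesis using that by auto
qed

lemma assoc_at_notin: "assoc_at V T A u \<Longrightarrow> u \<notin> multiples T"
  unfolding assoc_at_def by (metis add.right_neutral empty_subsetI keys_zero)

text \<open>Every monomial outside the ideal has a multiple that witnesses an associated prime.
  Bounded exponents in the generators confine the search to a finite box.\<close>

lemma exists_assoc_at:
  assumes V: "finite V" and t: "keys t \<subseteq> V" "t \<notin> multiples T"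
    and bound: "\<And>g i. g \<in> T \<Longrightarrow> lookup g i \<le> b"
  obtains A u where "assoc_at V T A u" "\<And>i. lookup t i \<le> lookup u i"
proof -
  define c where "c = max b (wdeg V t)"
  have tc: "lookup t i \<le> c" for i
  proof (cases "i \<in> V")
    case True
    then have "lookup t i \<le> wdeg V t" unfolding wdeg_def by (intro member_le_sum V) auto
    then show ?thesis by (simp add: c_def)
  qed (simp add: lookup_eq_0_outside[OF t(1)])
  \<comment> \<open>Beyond the bound \<open>c\<close> exponents are irrelevant for membership, so a maximal element of the
    box \<open>[t, c]\<close> outside \<open>multiples T\<close> has the required annihilator.\<close>
  define P where "P u \<longleftrightarrow> keys u \<subseteq> V \<and> u \<notin> multiples T \<and> (\<forall>i. lookup t i \<le> lookup u i \<and> lookup u i \<le> c)" for u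
  have "P t" using t tc by (simp add: P_def)
  moreover have "wdeg V u \<le> c * card V" if "P u" for u
    using that sum_bounded_above[of V "lookup u" c] by (simp add: P_def wdeg_def mult.commute)
  ultimately obtain u where u: "P u" and max: "\<And>y. P y \<Longrightarrow> wdeg V y \<le> wdeg V u"
    using ex_has_greatest_nat[of P t "wdeg V" "c * card V + 1"] by fastforce
  \<comment> \<open>Coordinates of \<open>V\<close> outside \<open>A\<close> have reached
    \<open>c\<close>, so raising them helps no further generator to divide; those in
    \<open>A\<close> are stopped only by the maximality of \<open>u\<close>.\<close>
  define A where "A = {i \<in> V. lookup u i < c}"
  have "u + evar i \<in> multiples T" if i: "i \<in> A" for i
  proof (rule ccontr)
    assume "u + evar i \<notin> multiples T"
    then have "P (u + evar i)" using i u
      by (auto simp: P_def A_def keys_add_nat lookup_add lookup_single when_def intro: le_SucI)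
    moreover have "wdeg V (evar i) > 0"
      using i by (subst wdeg_pos[OF V]) (auto simp: A_def lookup_single when_def)
    ultimately show False using max[of "u + evar i"] by (simp add: wdeg_add)
  qed
  moreover have "u + r \<notin> multiples T" if r: "keys r \<subseteq> V - A" for r
  proof
    assume "u + r \<in> multiples T"
    then obtain g where g: "g \<in> T" "\<And>i. lookup g i \<le> lookup u i + lookup r i"
      by (auto simp: multiples_def lookup_add)
    have "lookup g i \<le> lookup u i" for i
    proof (cases "i \<in> V - A")
      case True
      then have "lookup u i \<ge> b" by (auto simp: A_def c_def)
      then show ?thesis using bound[OF g(1), of i] by simp
    next
      case False
      then show ?thesis using g(2)[of i] lookup_eq_0_outside[OF r False] by simp
    qed
    then show False using u g(1) by (auto simp: P_def multiples_def)
  qed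
  ultimately have "assoc_at V T A u" using u by (auto simp: assoc_at_def A_def P_def)
  then show ?thesis using that u by (auto simp: P_def)
qed

text \<open>If a generator missed \<open>A\<close>, its \<open>s\<close>-th power would involve only
  variables outside \<open>A\<close> and still carry \<open>x^u\<close> into the ideal.\<close>

lemma assoc_at_cover:
  assumes "squarefree_exps V T" "assoc_at V (ksum T s) A u"
  shows "cover T A"
  unfolding cover_def
proof (rule ccontr)
  assume "\<not> (\<forall>g\<in>T. \<exists>i\<in>A. 0 < lookup g i)"
  then obtain e where e: "e \<in> T" "\<And>i. i \<in> A \<Longrightarrow> lookup e i = 0" by auto
  obtain r where r: "r \<in> ksum T s" "keys r \<subseteq> keys e" using ksum_keys_subset[OF e(1)] by blast
  have "keys e \<subseteq> V - A" using assms(1) e by (force simp: squarefree_exps_def in_keys_iff)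
  then have "u + r \<notin> multiples (ksum T s)" using assms(2) r(2) by (auto simp: assoc_at_def)
  then show False using r(1) by (auto simp: multiples_def lookup_add)
qed

text \<open>After inverting the variables outside a minimal cover \<open>A\<close>, each
  \<open>x_i\<close> with \<open>i \<in> A\<close> differs by a unit from its private generator. So
  the localised ideal is generated by the variables in \<open>A\<close>, and its \<open>s\<close>-th
  power is detected by weight alone.\<close>

lemma min_cover_saturation:
  assumes "finite V" "squarefree_exps V T" "min_cover V T A" "keys v \<subseteq> V" "s \<le> wdeg A v"
  obtains r where "keys r \<subseteq> V - A" "v + r \<in> multiples (ksum T s)"
proof -
  have fA: "finite A" using assms(1,3) by (auto simp: min_cover_def intro: finite_subset)
  have "\<exists>r. keys r \<subseteq> V - A \<and> v + r \<in> multiples (ksum T s)" using assms(4,5)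
  proof (induction s arbitrary: v)
    case 0
    show ?case by (rule exI[of _ 0]) (auto simp: multiples_def)
  next
    case (Suc s)
    then obtain i where i: "i \<in> A" "lookup v i > 0" using wdeg_pos[OF fA, of v] by auto
    obtain e where e: "e \<in> T" "lookup e i > 0" "\<And>k. k \<in> A \<Longrightarrow> k \<noteq> i \<Longrightarrow> lookup e k = 0"
      using min_cover_private[OF assms(3) i(1)] by blast
    have ei: "lookup e i = 1" "keys e \<subseteq> V" using e(1,2) assms(2)
      by (auto simp: squarefree_exps_def le_antisym Suc_leI)
    \<comment> \<open>One factor \<open>x_i\<close> is removed from \<open>x^v\<close>; the private
      generator \<open>x^e = x_i x^q\<close> replaces it, at the cost of the factor
      \<open>x^q\<close> outside \<open>A\<close>.\<close>
    define v' where "v' = v - evar i"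
    have v: "v = v' + evar i" using i(2)
      by (intro poly_mapping_eqI) (auto simp: v'_def lookup_add lookup_minus lookup_single when_def)
    have "wdeg A (evar i) = 1" using i(1) fA by (simp add: wdeg_def lookup_single when_def)
    then obtain r where r: "keys r \<subseteq> V - A" "v' + r \<in> multiples (ksum T s)"
      using Suc.IH[of v'] Suc.prems unfolding v wdeg_add keys_add_nat by auto
    obtain g where g: "g \<in> ksum T s" "\<And>k. lookup g k \<le> lookup (v' + r) k"
      using r(2) by (auto simp: multiples_def)
    define q where "q = e - evar i"
    have q: "e = q + evar i" using ei(1)
      by (intro poly_mapping_eqI) (auto simp: q_def lookup_add lookup_minus lookup_single when_def)
    have "keys q \<subseteq> V - A"
    proof
      fix k assume k: "k \<in> keys q"
      then have "k \<in> keys e" by (simp add: q keys_add_nat)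
      moreover have "k \<noteq> i" using k ei(1) by (auto simp: q_def in_keys_iff lookup_minus)
      ultimately show "k \<in> V - A" using e(3)[of k] ei(2) by (auto simp: in_keys_iff)
    qed
    moreover have "v + (r + q) \<in> multiples (ksum T (Suc s))"
    proof (rule multiplesI)
      show "g + e \<in> ksum T (Suc s)" using g(1) e(1) by auto
      show "lookup (g + e) k \<le> lookup (v + (r + q)) k" for k
        using g(2)[of k] by (simp add: v q lookup_add)
    qed
    ultimately show ?case using r(1) by (intro exI[of _ "r + q"]) (auto simp: keys_add_nat)
  qed
  then show ?thesis using that by blast
qed

lemma assoc_at_min_cover_wdeg:
  assumes "finite V" "squarefree_exps V T" "min_cover V T A" "assoc_at V (ksum T s) A u"
  shows "wdeg A u < s"
proof (rule ccontr)
  assume "\<not> wdeg A u < s"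
  then obtain r where "keys r \<subseteq> V - A" "u + r \<in> multiples (ksum T s)"
    using min_cover_saturation[OF assms(1,2,3), of u s] assms(4) by (auto simp: assoc_at_def)
  then show False using assms(4) by (auto simp: assoc_at_def)
qed

text \<open>Without embedded primes, a monomial in the symbolic but not in the ordinary power would
  have a multiple annihilated by a minimal prime, although its weight on that prime is at least
  \<open>s\<close>.\<close>

lemma powers_agreeI:
  assumes V: "finite V" and T: "squarefree_exps V T"
    and min: "\<And>A u. assoc_at V (ksum T s) A u \<Longrightarrow> min_cover V T A"
  shows "powers_agree V T s"
  unfolding powers_agree_def
proof (intro allI impI, rule ccontr)
  fix t assume t: "keys t \<subseteq> V" "\<forall>C\<subseteq>V. cover T C \<longrightarrow> s \<le> wdeg C t" "t \<notin> multiples (ksum T s)"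
  obtain A u where Au: "assoc_at V (ksum T s) A u" "\<And>i. lookup t i \<le> lookup u i"
    using exists_assoc_at[OF V t(1,3)] ksum_lookup_le[OF T] by metis
  have A: "min_cover V T A" by (rule min[OF Au(1)])
  then have "s \<le> wdeg A t" using t(2) by (simp add: min_cover_def)
  also have "\<dots> \<le> wdeg A u" using Au(2) by (rule wdeg_mono)
  finally show False using assoc_at_min_cover_wdeg[OF V T A Au(1)] by simp
qed

section \<open>Ordinary and symbolic powers under deletion and contraction\<close>

lemma squarefree_exps_delete:
  "squarefree_exps V T \<Longrightarrow> squarefree_exps (V - {j}) {t \<in> T. lookup t j = 0}"
  by (auto simp: squarefree_exps_def in_keys_iff)

lemma squarefree_exps_reset:
  "squarefree_exps V T \<Longrightarrow> squarefree_exps (V - {j}) (Poly_Mapping.update j 0 ` T)"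
  by (auto simp: squarefree_exps_def keys_reset lookup_reset)

lemma powers_agree_delete:
  assumes "powers_agree V T s"
  shows "powers_agree (V - {j}) {t \<in> T. lookup t j = 0} s"
  unfolding powers_agree_def
proof (intro allI impI)
  fix t assume t: "keys t \<subseteq> V - {j}"
    and c: "\<forall>C\<subseteq>V - {j}. cover {t \<in> T. lookup t j = 0} C \<longrightarrow> s \<le> wdeg C t"
  have tj: "lookup t j = 0" using t by (rule lookup_eq_0_outside) simp
  have "s \<le> wdeg C t" if C: "C \<subseteq> V" "cover T C" for C
  proof -
    \<comment> \<open>Index \<open>j\<close> covers no generator that lacks \<open>x_j\<close>, and
      dropping it costs no weight because \<open>t\<close> vanishes at \<open>j\<close>.\<close>
    have "cover {t \<in> T. lookup t j = 0} (C - {j})"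
      using C(2) by (fastforce simp: cover_def)
    then have "s \<le> wdeg (C - {j}) t" using c C(1) by blast
    also have "\<dots> = wdeg C t" unfolding wdeg_def
      by (cases "finite C") (auto simp: sum_diff1_nat tj)
    finally show ?thesis .
  qed
  then have "t \<in> multiples (ksum T s)" using assms t unfolding powers_agree_def by blast
  then obtain g where g: "g \<in> ksum T s" "\<And>i. lookup g i \<le> lookup t i" by (auto simp: multiples_def)
  have "g \<in> ksum {t \<in> T. lookup t j = 0} s"
    using g(1) g(2)[of j] tj by (simp flip: ksum_nolookup)
  then show "t \<in> multiples (ksum {t \<in> T. lookup t j = 0} s)" using g(2) by (rule multiplesI)
qed

lemma cover_reset: "j \<notin> C \<Longrightarrow> cover (Poly_Mapping.update j 0 ` T) C \<longleftrightarrow> cover T C"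
  unfolding cover_def by (auto simp: lookup_reset)

lemma powers_agree_reset:
  assumes "finite V" "powers_agree V T s" "j \<in> V"
  shows "powers_agree (V - {j}) (Poly_Mapping.update j 0 ` T) s"
  unfolding powers_agree_def
proof (intro allI impI)
  fix t assume t: "keys t \<subseteq> V - {j}"
    and c: "\<forall>C\<subseteq>V - {j}. cover (Poly_Mapping.update j 0 ` T) C \<longrightarrow> s \<le> wdeg C t"
  \<comment> \<open>The factor \<open>x_j^s\<close> gives weight \<open>s\<close> to covers through
    \<open>j\<close>; covers avoiding \<open>j\<close> are covers of the contraction.\<close>
  have "s \<le> wdeg C (t + single j s)" if C: "C \<subseteq> V" "cover T C" for C
  proof (cases "j \<in> C")
    case True
    then have "s \<le> wdeg C (single j s)" using finite_subset[OF C(1) assms(1)]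
      by (simp add: wdeg_def lookup_single when_def)
    then show ?thesis by (simp add: wdeg_add)
  next
    case False
    then have "s \<le> wdeg C t" using c C cover_reset[OF False] by blast
    then show ?thesis by (simp add: wdeg_add)
  qed
  moreover have "keys (t + single j s) \<subseteq> V" using t assms(3) by (auto simp: keys_add_nat)
  ultimately have "t + single j s \<in> multiples (ksum T s)"
    using assms(2) unfolding powers_agree_def by blast
  then show "t \<in> multiples (ksum (Poly_Mapping.update j 0 ` T) s)"
    unfolding ksum_reset by (rule multiples_imp_reset) (simp add: lookup_add lookup_single when_def)
qed

text \<open>Contracting inverts \<open>x_k\<close>, so an associated prime of the contraction lifts
  to one of the original power that avoids \<open>x_k\<close>.\<close>

lemma assoc_at_reset:
  assumes "squarefree_exps V T" "k \<in> V"
    and "assoc_at (V - {k}) (ksum (Poly_Mapping.update k 0 ` T) s) A u"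
  shows "assoc_at V (ksum T s) A (u + single k s)"
proof -
  have "u + single k s + evar i \<in> multiples (ksum T s)" if "i \<in> A" for i
    using multiples_reset[of "ksum T s" k s "u + evar i"] assms(3) that ksum_lookup_le[OF assms(1)]
    by (simp add: assoc_at_def ksum_reset ac_simps)
  moreover have "u + single k s + r \<notin> multiples (ksum T s)" if r: "keys r \<subseteq> V - A" for r
  proof
    assume "u + single k s + r \<in> multiples (ksum T s)"
    \<comment> \<open>The monomial \<open>x^r\<close> may involve \<open>x_k\<close>, as
      \<open>k \<notin> A\<close>; that part disappears in the contraction.\<close>
    then have "u + Poly_Mapping.update k 0 r \<in> multiples (ksum (Poly_Mapping.update k 0 ` T) s)"
      unfolding ksum_reset
      by (rule multiples_imp_reset) (simp add: lookup_add lookup_single lookup_reset when_def)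
    moreover have "keys (Poly_Mapping.update k 0 r) \<subseteq> V - {k} - A"
      using r by (auto simp: keys_reset)
    ultimately show False using assms(3) unfolding assoc_at_def by blast
  qed
  ultimately show ?thesis using assms(2,3) by (auto simp: assoc_at_def keys_add_nat)
qed

section \<open>Monomial ideals\<close>

abbreviation xpow :: "(nat \<Rightarrow>\<^sub>0 nat) \<Rightarrow> 'k::field mpoly" where
  "xpow t \<equiv> single t 1"

lemma xpow_inject [simp]: "(xpow a :: 'k::field mpoly) = xpow b \<longleftrightarrow> a = b"
  by (metis keys_single singleton_inject zero_neq_one)

text \<open>A polynomial lies in a monomial ideal iff all its terms do. Taking this as the
  definition reduces membership to exponents; \<open>Idl_xpow\<close> identifies it with the
  generated ideal.\<close>

definition mideal :: "nat set \<Rightarrow> (nat \<Rightarrow>\<^sub>0 nat) set \<Rightarrow> 'k::field mpoly set" where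
  "mideal V T = {p \<in> carrier (poly_ring V). keys p \<subseteq> multiples T}"

abbreviation var_prime :: "nat set \<Rightarrow> nat set \<Rightarrow> 'k::field mpoly set" where
  "var_prime V A \<equiv> mideal V (evar ` A)"

lemma poly_ring_simps [simp]:
  "p \<in> carrier (poly_ring V) \<longleftrightarrow> (\<forall>t\<in>keys p. keys t \<subseteq> V)"
  "p \<otimes>\<^bsub>poly_ring V\<^esub> q = p * q" "p \<oplus>\<^bsub>poly_ring V\<^esub> q = p + q"
  "\<one>\<^bsub>poly_ring V\<^esub> = 1" "\<zero>\<^bsub>poly_ring V\<^esub> = 0"
  by (simp_all add: poly_ring_def)

lemma poly_ring_ring: "ring (poly_ring V :: 'k::field mpoly ring)"
  by (rule cring.axioms(1)[OF poly_ring_cring])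

lemma mult_in_carrier:
  fixes p q :: "'k::field mpoly"
  shows "p \<in> carrier (poly_ring V) \<Longrightarrow> q \<in> carrier (poly_ring V) \<Longrightarrow> p * q \<in> carrier (poly_ring V)"
  using monoid.m_closed[OF ring.is_monoid[OF poly_ring_ring], of p V q] by (simp only: poly_ring_simps(2))

lemma a_inv_poly_ring:
  fixes p :: "'k::field mpoly"
  assumes "p \<in> carrier (poly_ring V)"
  shows "\<ominus>\<^bsub>poly_ring V\<^esub> p = - p"
  by (rule abelian_group.minus_equality[OF ring.is_abelian_group[OF poly_ring_ring]])
     (use assms in auto)

lemma mem_mideal: "p \<in> mideal V T \<longleftrightarrow> (\<forall>t\<in>keys p. keys t \<subseteq> V \<and> t \<in> multiples T)"
  by (auto simp: mideal_def)

lemma mideal_carrier: "mideal V T \<subseteq> carrier (poly_ring V)"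
  by (auto simp: mideal_def)

lemma mideal_cong: "multiples S = multiples T \<Longrightarrow> mideal V S = mideal V T"
  by (simp add: mideal_def)

lemma keys_multE:
  fixes p q :: "'k::field mpoly"
  assumes "t \<in> keys (p * q)"
  obtains a b where "t = a + b" "a \<in> keys p" "b \<in> keys q"
  using assms keys_mult[of p q] by blast

lemma mult_mem_mideal:
  assumes "p \<in> mideal V S" "q \<in> mideal V T"
  shows "p * q \<in> mideal V {a + b |a b. a \<in> S \<and> b \<in> T}"
  unfolding mem_mideal
proof
  fix t assume "t \<in> keys (p * q)"
  then obtain a b where ab: "t = a + b" "a \<in> keys p" "b \<in> keys q" by (rule keys_multE)
  obtain g h where "g \<in> S" "h \<in> T" "\<And>i. lookup g i \<le> lookup a i" "\<And>i. lookup h i \<le> lookup b i"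
    using ab assms unfolding mem_mideal multiples_def by blast
  then have "t \<in> multiples {a + b |a b. a \<in> S \<and> b \<in> T}"
    by (intro multiplesI[of "g + h"]) (auto simp: ab(1) lookup_add add_mono)
  then show "keys t \<subseteq> V \<and> t \<in> multiples {a + b |a b. a \<in> S \<and> b \<in> T}"
    using ab assms by (auto simp: mem_mideal keys_add_nat)
qed

lemma mideal_zero: "mideal V {0} = carrier (poly_ring V)"
  by (auto simp: mem_mideal multiples_def)

lemma add_mem_mideal: "p \<in> mideal V T \<Longrightarrow> q \<in> mideal V T \<Longrightarrow> p + q \<in> mideal V T"
  using Poly_Mapping.keys_add[of p q] unfolding mem_mideal by blast

lemma mult_l_mem_mideal: "p \<in> mideal V T \<Longrightarrow> q \<in> carrier (poly_ring V) \<Longrightarrow> q * p \<in> mideal V T"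
  using mult_mem_mideal[of q V "{0}" p T] by (simp add: mideal_zero)

lemma mideal_ideal: "ideal (mideal V T) (poly_ring V :: 'k::field mpoly ring)"
proof (rule idealI)
  show "ring (poly_ring V :: 'k mpoly ring)" by (rule poly_ring_ring)
  show "subgroup (mideal V T) (add_monoid (poly_ring V :: 'k mpoly ring))"
  proof
    fix x :: "'k mpoly" assume x: "x \<in> mideal V T"
    have "inv\<^bsub>add_monoid (poly_ring V)\<^esub> x = - x"
      using a_inv_poly_ring[of x V] x mideal_carrier unfolding a_inv_def by blast
    then show "inv\<^bsub>add_monoid (poly_ring V)\<^esub> x \<in> mideal V T" using x by (simp add: mem_mideal)
  qed (use mideal_carrier in \<open>auto simp: mem_mideal dest!: subsetD[OF Poly_Mapping.keys_add]\<close>)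
  fix a x :: "'k mpoly" assume "a \<in> mideal V T" "x \<in> carrier (poly_ring V)"
  then show "x \<otimes>\<^bsub>poly_ring V\<^esub> a \<in> mideal V T" "a \<otimes>\<^bsub>poly_ring V\<^esub> x \<in> mideal V T"
    using mult_l_mem_mideal[of a V T x] by (simp_all add: mult.commute)
qed

section \<open>Generators, products and powers of monomial ideals\<close>

lemma sum_single_keys: "p = (\<Sum>t\<in>keys p. single t (lookup p t))"
  by (rule poly_mapping_eqI)
     (auto simp: lookup_sum lookup_single when_def in_keys_iff)

text \<open>\<open>H\<close> may contain \<open>0\<close> besides the monomials because deletion
  sends the generators divisible by \<open>x_j\<close> to \<open>0\<close>.\<close>

lemma Idl_monomials:
  fixes H :: "'k::field mpoly set"
  assumes "\<forall>t\<in>T. keys t \<subseteq> V" and "xpow ` T \<subseteq> H" and "H \<subseteq> insert 0 (xpow ` T)"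
  shows "Idl\<^bsub>poly_ring V\<^esub> H = mideal V T"
proof
  interpret R: ring "poly_ring V :: 'k mpoly ring" by (rule poly_ring_ring)
  have H: "H \<subseteq> mideal V T"
    using assms(1,3) subset_multiples[of T] by (fastforce simp: mem_mideal)
  then show "Idl\<^bsub>poly_ring V\<^esub> H \<subseteq> mideal V T"
    by (rule R.genideal_minimal[OF mideal_ideal])
  have HC: "H \<subseteq> carrier (poly_ring V)" using H mideal_carrier by blast
  interpret I: ideal "Idl\<^bsub>poly_ring V\<^esub> H" "poly_ring V" by (rule R.genideal_ideal[OF HC])
  show "mideal V T \<subseteq> Idl\<^bsub>poly_ring V\<^esub> H"
  proof
    fix p :: "'k mpoly" assume p: "p \<in> mideal V T"
    have term_in: "single t (lookup p t) \<in> Idl\<^bsub>poly_ring V\<^esub> H" if t: "t \<in> keys p" for t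
    proof -
      obtain g where g: "g \<in> T" "\<And>i. lookup g i \<le> lookup t i"
        using p t unfolding mem_mideal multiples_def by blast
      have "keys (t - g) \<subseteq> keys t" by (auto simp: in_keys_iff lookup_minus)
      then have c: "single (t - g) (lookup p t) \<in> carrier (poly_ring V)"
        using p t by (auto simp: mem_mideal split: if_splits)
      have "t = t - g + g" using g(2)
        by (intro poly_mapping_eqI) (simp add: lookup_add lookup_minus)
      then have "single t (lookup p t) = single (t - g) (lookup p t) * xpow g"
        by (simp add: mult_single)
      moreover have "xpow g \<in> Idl\<^bsub>poly_ring V\<^esub> H"
        using R.genideal_self[OF HC] assms(2) g(1) by blast
      ultimately show ?thesis using I.I_l_closed[OF _ c] by simp
    qed
    have "(\<Sum>t\<in>F. single t (lookup p t)) \<in> Idl\<^bsub>poly_ring V\<^esub> H" if "finite F" "F \<subseteq> keys p" for F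
      using that
    proof (induction F rule: finite_induct)
      case empty
      then show ?case using I.zero_closed by simp
    next
      case (insert t F)
      then show ?case using I.a_closed[OF term_in[of t]] by simp
    qed
    then show "p \<in> Idl\<^bsub>poly_ring V\<^esub> H" using sum_single_keys[of p] by (metis finite_keys order_refl)
  qed
qed

lemma Idl_xpow:
  "\<forall>t\<in>T. keys t \<subseteq> V \<Longrightarrow> Idl\<^bsub>poly_ring V\<^esub> (xpow ` T) = (mideal V T :: 'k::field mpoly set)"
  by (rule Idl_monomials) auto

lemma xpow_mem_mideal: "keys t \<subseteq> V \<Longrightarrow> (xpow t :: 'k::field mpoly) \<in> mideal V T \<longleftrightarrow> t \<in> multiples T"
  by (simp add: mem_mideal)

lemma ideal_prod_mideal:
  assumes "\<forall>t\<in>S. keys t \<subseteq> V" "\<forall>t\<in>T. keys t \<subseteq> V"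
  shows "ideal_prod (poly_ring V) (mideal V S) (mideal V T) =
    (mideal V {a + b |a b. a \<in> S \<and> b \<in> T} :: 'k::field mpoly set)" (is "?P = mideal V ?U")
proof
  interpret R: ring "poly_ring V :: 'k mpoly ring" by (rule poly_ring_ring)
  show "?P \<subseteq> mideal V ?U"
  proof
    fix p assume "p \<in> ?P"
    then show "p \<in> mideal V ?U"
      by (induction rule: ideal_prod.induct) (simp_all add: mult_mem_mideal add_mem_mideal)
  qed
  have "mideal V ?U = Idl\<^bsub>poly_ring V\<^esub> (xpow ` ?U :: 'k mpoly set)"
    using assms by (intro Idl_xpow[symmetric]) (force simp: keys_add_nat)
  also have "\<dots> \<subseteq> ?P"
  proof (rule R.genideal_minimal)
    show "ideal ?P (poly_ring V)" by (intro R.ideal_prod_is_ideal mideal_ideal)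
    have "xpow a * xpow b \<in> ?P" if "a \<in> S" "b \<in> T" for a b
    proof -
      have "xpow a \<in> (mideal V S :: 'k mpoly set)" "xpow b \<in> (mideal V T :: 'k mpoly set)"
        using that assms subsetD[OF subset_multiples] by (auto simp: xpow_mem_mideal)
      then show ?thesis using ideal_prod.prod[of "xpow a" "mideal V S" "xpow b" "mideal V T" "poly_ring V"]
        by simp
    qed
    then show "xpow ` ?U \<subseteq> ?P" by (auto simp: mult_single)
  qed
  finally show "mideal V ?U \<subseteq> ?P" .
qed

lemma ideal_power_mideal:
  assumes "\<forall>t\<in>T. keys t \<subseteq> V"
  shows "ideal_power (poly_ring V) (mideal V T) k = (mideal V (ksum T k) :: 'k::field mpoly set)"
proof (induction k)
  case 0
  then show ?case by (simp add: ideal_power_def nat_pow_def ideals_set_def mideal_zero)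
next
  case (Suc k)
  have "ideal_power (poly_ring V) (mideal V T) (Suc k) =
      ideal_prod (poly_ring V) (ideal_power (poly_ring V) (mideal V T) k) (mideal V T :: 'k mpoly set)"
    by (simp add: ideal_power_def nat_pow_def ideals_set_def)
  then show ?case using ideal_prod_mideal[OF ksum_keys[OF assms] assms, of k, where ?'k = 'k] Suc by simp
qed

section \<open>Terms that survive in a product\<close>

lemma split_key:
  fixes p :: "'k::field mpoly"
  obtains p' where "p = single t (lookup p t) + p'" "keys p' = keys p - {t}"
proof
  show "p = single t (lookup p t) + (p - single t (lookup p t))" by simp
  show "keys (p - single t (lookup p t)) = keys p - {t}"
    by (auto simp: in_keys_iff lookup_minus lookup_single when_def split: if_splits)
qed

text \<open>If \<open>a + b\<close> arises from one pair of keys only, its coefficient is a product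
  of two nonzero field elements, so nothing cancels.\<close>

lemma key_mult_unique:
  fixes p q :: "'k::field mpoly"
  assumes "a \<in> keys p" "b \<in> keys q"
    and unique: "\<And>x y. x \<in> keys p \<Longrightarrow> y \<in> keys q \<Longrightarrow> x + y = a + b \<Longrightarrow> x = a"
  shows "a + b \<in> keys (p * q)"
proof -
  obtain p' where p: "p = single a (lookup p a) + p'" and p': "keys p' = keys p - {a}"
    by (rule split_key)
  obtain q' where q: "q = single b (lookup q b) + q'" and q': "keys q' = keys q - {b}"
    by (rule split_key)
  have "p * q = single a (lookup p a) * q + p' * q"
    by (subst p) (simp add: distrib_right)
  also have "single a (lookup p a) * q = single (a + b) (lookup p a * lookup q b) + single a (lookup p a) * q'"
    by (subst q) (simp add: distrib_left mult_single)
  finally have "lookup (p * q) (a + b) = lookup p a * lookup q b +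
      lookup (single a (lookup p a) * q') (a + b) + lookup (p' * q) (a + b)"
    by (simp add: lookup_add)
  moreover have "a + b \<notin> keys (p' * q)"
  proof
    assume "a + b \<in> keys (p' * q)"
    then obtain x y where xy: "a + b = x + y" "x \<in> keys p'" "y \<in> keys q" by (rule keys_multE)
    then have "x = a" using unique[of x y] p' by simp
    then show False using xy(2) p' by simp
  qed
  moreover have "a + b \<notin> keys (single a (lookup p a) * q')"
  proof
    assume "a + b \<in> keys (single a (lookup p a) * q')"
    then obtain x y where "a + b = x + y" "x \<in> keys (single a (lookup p a))" "y \<in> keys q'"
      by (rule keys_multE)
    then show False using q' by (simp split: if_splits)
  qed
  ultimately show ?thesis using assms(1,2) by (simp add: in_keys_iff)
qed

text \<open>The order along \<open>C\<close> is additive: suitable terms of least weight in the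
  factors multiply to a surviving term.\<close>

lemma key_mult_wdeg:
  fixes p q :: "'k::field mpoly"
  assumes "a \<in> keys p" "b \<in> keys q"
  obtains t where "t \<in> keys (p * q)" "wdeg C t \<le> wdeg C a + wdeg C b"
proof -
  \<comment> \<open>The library's linear order on exponent vectors breaks ties among keys of minimal weight.\<close>
  have least: "\<exists>m\<in>S. \<forall>x\<in>S. wdeg C m \<le> wdeg C x \<and> (wdeg C x = wdeg C m \<longrightarrow> m \<le> x)"
    if S: "finite S" "S \<noteq> {}" for S
  proof -
    define d where "d = Min (wdeg C ` S)"
    define S' where "S' = {x \<in> S. wdeg C x = d}"
    have "d \<in> wdeg C ` S" unfolding d_def using S by (intro Min_in) auto
    then have S': "finite S'" "S' \<noteq> {}" using S by (auto simp: S'_def)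
    have "Min S' \<in> S'" by (rule Min_in[OF S'])
    moreover have "d \<le> wdeg C x" if "x \<in> S" for x using that S by (auto simp: d_def)
    moreover have "Min S' \<le> x" if "x \<in> S'" for x using that S' by simp
    ultimately show ?thesis by (intro bexI[of _ "Min S'"]) (auto simp: S'_def)
  qed
  have fin: "finite (keys p)" "finite (keys q)" by simp_all
  obtain a' where a': "a' \<in> keys p"
      "\<And>x. x \<in> keys p \<Longrightarrow> wdeg C a' \<le> wdeg C x \<and> (wdeg C x = wdeg C a' \<longrightarrow> a' \<le> x)"
    using least[of "keys p"] fin assms(1) by blast
  obtain b' where b': "b' \<in> keys q"
      "\<And>x. x \<in> keys q \<Longrightarrow> wdeg C b' \<le> wdeg C x \<and> (wdeg C x = wdeg C b' \<longrightarrow> b' \<le> x)"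
    using least[of "keys q"] fin assms(2) by blast
  have "a' + b' \<in> keys (p * q)"
  proof (rule key_mult_unique[OF a'(1) b'(1)])
    fix x y assume xy: "x \<in> keys p" "y \<in> keys q" "x + y = a' + b'"
    then have "wdeg C x + wdeg C y = wdeg C a' + wdeg C b'" by (metis wdeg_add)
    then have "wdeg C x = wdeg C a'" "wdeg C y = wdeg C b'"
      using a'(2)[OF xy(1)] b'(2)[OF xy(2)] by linarith+
    then have "a' \<le> x" "b' \<le> y" using a'(2)[OF xy(1)] b'(2)[OF xy(2)] by auto
    then show "x = a'" using xy(3) add_less_le_mono[of a' x b' y] by (metis less_irrefl order_le_less)
  qed
  moreover have "wdeg C (a' + b') \<le> wdeg C a + wdeg C b"
    using a'(2)[OF assms(1)] b'(2)[OF assms(2)] by (simp add: wdeg_add)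
  ultimately show ?thesis by (rule that)
qed

section \<open>Associated primes of monomial ideals\<close>

lemma Ass_iff:
  fixes R (structure)
  assumes "cring R" "ideal J R"
  shows "P \<in> Ass R J \<longleftrightarrow> primeideal P R \<and> (\<exists>f\<in>carrier R. P = {r \<in> carrier R. r \<otimes> f \<in> J})"
proof -
  interpret cring R by fact
  interpret J: ideal J R by fact
  have zero: "J +> x = J \<longleftrightarrow> x \<in> J" if "x \<in> carrier R" for x
    using that J.rcos_const_imp_mem J.a_rcos_const by blast
  have "{r \<in> carrier R. (J +> r) \<otimes>\<^bsub>R Quot J\<^esub> (J +> f) = \<zero>\<^bsub>R Quot J\<^esub>} = {r \<in> carrier R. r \<otimes> f \<in> J}"
    if "f \<in> carrier R" for f
    by (intro Collect_cong conj_cong refl) (simp add: that FactRing_def J.rcoset_mult_add zero)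
  moreover have "carrier (R Quot J) = (\<lambda>f. J +> f) ` carrier R"
    by (auto simp: FactRing_def A_RCOSETS_def')
  ultimately show ?thesis unfolding Ass_def by auto
qed

lemmas Ass_mideal_iff = Ass_iff[OF poly_ring_cring mideal_ideal, unfolded poly_ring_simps(2)]

section \<open>Primes generated by variables\<close>

lemma multiples_evar: "t \<in> multiples (evar ` A) \<longleftrightarrow> (\<exists>i\<in>A. lookup t i > 0)"
proof
  assume "\<exists>i\<in>A. lookup t i > 0"
  then obtain i where "i \<in> A" "lookup t i > 0" by blast
  then show "t \<in> multiples (evar ` A)"
    by (intro multiplesI[of "evar i"]) (auto simp: lookup_single when_def)
next
  assume "t \<in> multiples (evar ` A)"
  then obtain i where "i \<in> A" "\<And>k. lookup (evar i) k \<le> lookup t k" by (auto simp: multiples_def)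
  from this(1) this(2)[of i] show "\<exists>i\<in>A. lookup t i > 0" by (auto simp: Suc_le_eq)
qed

lemma mem_var_prime:
  "finite A \<Longrightarrow> p \<in> var_prime V A \<longleftrightarrow> p \<in> carrier (poly_ring V) \<and> (\<forall>t\<in>keys p. wdeg A t > 0)"
  by (auto simp: mem_mideal multiples_evar wdeg_pos)

text \<open>Factors outside the prime each have a term of weight zero on \<open>A\<close>, and then
  so does their product.\<close>

lemma var_prime_primeideal:
  assumes "finite A"
  shows "primeideal (var_prime V A) (poly_ring V :: 'k::field mpoly ring)"
proof (rule primeidealI[OF mideal_ideal poly_ring_cring])
  have "1 \<in> carrier (poly_ring V :: 'k mpoly ring)" "1 \<notin> (var_prime V A :: 'k mpoly set)"
    using assms by (simp_all add: mem_var_prime wdeg_def)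
  then show "carrier (poly_ring V) \<noteq> (var_prime V A :: 'k mpoly set)" by blast
  fix p q :: "'k mpoly"
  assume pq: "p \<in> carrier (poly_ring V)" "q \<in> carrier (poly_ring V)"
    "p \<otimes>\<^bsub>poly_ring V\<^esub> q \<in> var_prime V A"
  show "p \<in> var_prime V A \<or> q \<in> var_prime V A"
  proof (rule ccontr)
    assume "\<not> ?thesis"
    then obtain a b where ab: "a \<in> keys p" "wdeg A a = 0" "b \<in> keys q" "wdeg A b = 0"
      using pq(1,2) assms unfolding mem_var_prime[OF assms] by auto
    obtain t where "t \<in> keys (p * q)" "wdeg A t \<le> wdeg A a + wdeg A b"
      by (rule key_mult_wdeg[OF ab(1,3)])
    then show False using ab pq(3) by (auto simp: mem_var_prime[OF assms])
  qed
qed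

lemma var_prime_subset_iff:
  assumes "A \<subseteq> V"
  shows "(var_prime V A :: 'k::field mpoly set) \<subseteq> var_prime V B \<longleftrightarrow> A \<subseteq> B"
proof
  assume *: "(var_prime V A :: 'k mpoly set) \<subseteq> var_prime V B"
  show "A \<subseteq> B"
  proof
    fix i assume i: "i \<in> A"
    then have "xpow (evar i) \<in> (var_prime V A :: 'k mpoly set)"
      using assms by (auto simp: xpow_mem_mideal multiples_evar)
    then have "xpow (evar i) \<in> (var_prime V B :: 'k mpoly set)" using * by blast
    then show "i \<in> B" using i assms
      by (auto simp: mem_mideal multiples_evar lookup_single when_def split: if_splits)
  qed
qed (fastforce simp: mem_mideal multiples_evar)

lemma mideal_subset_var_prime_iff:
  assumes "\<forall>t\<in>T. keys t \<subseteq> V"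
  shows "(mideal V T :: 'k::field mpoly set) \<subseteq> var_prime V A \<longleftrightarrow> cover T A"
proof
  assume *: "(mideal V T :: 'k mpoly set) \<subseteq> var_prime V A"
  have "t \<in> multiples (evar ` A)" if "t \<in> T" for t
  proof -
    have "xpow t \<in> (mideal V T :: 'k mpoly set)"
      using assms that subsetD[OF subset_multiples] by (auto simp: xpow_mem_mideal)
    then have "xpow t \<in> (var_prime V A :: 'k mpoly set)" using * by blast
    then show ?thesis using assms that by (simp add: xpow_mem_mideal)
  qed
  then show "cover T A" by (auto simp: cover_def multiples_evar)
next
  assume "cover T A"
  then have "T \<subseteq> multiples (evar ` A)" by (auto simp: cover_def multiples_evar)
  then have "multiples T \<subseteq> multiples (evar ` A)" by (rule multiples_subset)
  then show "(mideal V T :: 'k mpoly set) \<subseteq> var_prime V A" by (auto simp: mideal_def)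
qed

lemma Min_primes_min_cover:
  assumes "finite V" "\<forall>t\<in>T. keys t \<subseteq> V" "A \<subseteq> V"
    and "(var_prime V A :: 'k::field mpoly set) \<in> Min_primes (poly_ring V) (mideal V T)"
  shows "min_cover V T A"
  unfolding min_cover_def
proof (intro conjI allI impI notI)
  show "cover T A" using assms(4) mideal_subset_var_prime_iff[OF assms(2), where ?'k = 'k]
    by (auto simp: Min_primes_def)
  fix B assume B: "B \<subset> A" "cover T B"
  then have fB: "finite B" using assms(1,3) by (meson finite_subset psubset_imp_subset)
  have "(var_prime V B :: 'k mpoly set) \<subseteq> var_prime V A"
    using B assms(3) by (subst var_prime_subset_iff) auto
  moreover have "(mideal V T :: 'k mpoly set) \<subseteq> var_prime V B"
    using mideal_subset_var_prime_iff[OF assms(2)] B(2) by blast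
  ultimately have "(var_prime V B :: 'k mpoly set) = var_prime V A"
    using assms(4) var_prime_primeideal[OF fB] unfolding Min_primes_def by blast
  then have "A \<subseteq> B" using var_prime_subset_iff[OF assms(3), of B, where ?'k = 'k] by simp
  then show False using B(1) by blast
qed (rule assms(3))

text \<open>Multiplication by \<open>x^u\<close> shifts exponents injectively, so the annihilator of
  its class can be read off term by term.\<close>

lemma assoc_at_imp_Ass:
  assumes "finite V" "assoc_at V T A u"
  shows "(var_prime V A :: 'k::field mpoly set) \<in> Ass (poly_ring V) (mideal V T)"
proof -
  have A: "finite A" "A \<subseteq> V" "keys u \<subseteq> V"
    using assms by (auto simp: assoc_at_def intro: finite_subset)
  have u: "(xpow u :: 'k mpoly) \<in> carrier (poly_ring V)" using A(3) by simp
  have "r * xpow u \<in> mideal V T \<longleftrightarrow> (\<forall>t\<in>keys r. t \<in> multiples (evar ` A))"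
    if r: "r \<in> carrier (poly_ring V)" for r :: "'k mpoly"
  proof
    assume ru: "r * xpow u \<in> mideal V T"
    show "\<forall>t\<in>keys r. t \<in> multiples (evar ` A)"
    proof (rule ballI, rule ccontr)
      fix t assume t: "t \<in> keys r" "t \<notin> multiples (evar ` A)"
      have "t + u \<in> keys (r * xpow u)" by (rule key_mult_unique) (use t in auto)
      then have "u + t \<in> multiples T" using ru by (auto simp: mem_mideal add.commute)
      moreover have "keys t \<subseteq> V - A"
      proof
        fix i assume i: "i \<in> keys t"
        have "i \<notin> A" using t(2) i by (auto simp: multiples_evar in_keys_iff)
        moreover have "keys t \<subseteq> V" using r t(1) by simp
        ultimately show "i \<in> V - A" using i by blast
      qed
      ultimately show False using assms(2) by (auto simp: assoc_at_def)
    qed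
  next
    assume *: "\<forall>t\<in>keys r. t \<in> multiples (evar ` A)"
    have "t + u \<in> multiples T" if t: "t \<in> keys r" for t
    proof -
      obtain i where i: "i \<in> A" "lookup t i > 0" using * t by (auto simp: multiples_evar)
      then have "u + evar i \<in> multiples T" using assms(2) by (auto simp: assoc_at_def)
      then show ?thesis
        by (rule multiples_mono) (use i in \<open>auto simp: lookup_add lookup_single when_def\<close>)
    qed
    moreover have "r * xpow u \<in> carrier (poly_ring V)" by (rule mult_in_carrier[OF r u])
    moreover have "t \<in> multiples T" if "t \<in> keys (r * xpow u)" for t
    proof -
      obtain x y where "t = x + y" "x \<in> keys r" "y \<in> keys (xpow u :: 'k mpoly)"
        using \<open>t \<in> keys (r * xpow u)\<close> by (rule keys_multE)
      then show ?thesis using \<open>\<And>t. t \<in> keys r \<Longrightarrow> t + u \<in> multiples T\<close> by simp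
    qed
    ultimately show "r * xpow u \<in> mideal V T" unfolding mideal_def by blast
  qed
  then have "(var_prime V A :: 'k mpoly set) = {r \<in> carrier (poly_ring V). r * xpow u \<in> mideal V T}"
    unfolding mideal_def[of V "evar ` A"] by blast
  then show ?thesis unfolding Ass_mideal_iff using u var_prime_primeideal[OF A(1)] by blast
qed

text \<open>The prime \<open>P\<close>, a priori not monomial, is squeezed between variable primes.
  A term of \<open>f\<close> outside the power yields a minimal cover \<open>A\<close> with
  \<open>P \<subseteq> var_prime V A\<close>; the variables inside \<open>P\<close> form a cover
  contained in \<open>A\<close>, hence all of \<open>A\<close>.\<close>

lemma Ass_ksum_min_cover:
  assumes V: "finite V" and T: "squarefree_exps V T" and agree: "powers_agree V T s"
    and P: "(P :: 'k::field mpoly set) \<in> Ass (poly_ring V) (mideal V (ksum T s))"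
  obtains A where "min_cover V T A" "P = var_prime V A"
proof -
  have TV: "\<forall>t\<in>T. keys t \<subseteq> V" using T by (auto simp: squarefree_exps_def)
  obtain f where P': "primeideal P (poly_ring V)" and f: "f \<in> carrier (poly_ring V)"
      "P = {r \<in> carrier (poly_ring V). r * f \<in> mideal V (ksum T s)}"
    using P unfolding Ass_mideal_iff by blast
  interpret P: primeideal P "poly_ring V" by (rule P')
  have "\<not> (\<forall>t\<in>keys f. t \<in> multiples (ksum T s))"
  proof
    assume "\<forall>t\<in>keys f. t \<in> multiples (ksum T s)"
    then have "f \<in> mideal V (ksum T s)" using f(1) by (simp add: mem_mideal)
    then have "P = carrier (poly_ring V)" using f(2) mult_l_mem_mideal[of f V "ksum T s"] by blast
    then show False using P.I_notcarr by simp
  qed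
  then obtain t where t: "t \<in> keys f" "t \<notin> multiples (ksum T s)" by blast
  then obtain C where C: "C \<subseteq> V" "cover T C" "wdeg C t < s"
    using agree f(1) unfolding powers_agree_def by (metis not_le poly_ring_simps(1))
  obtain A where A: "A \<subseteq> C" "min_cover V T A"
    using exists_min_cover[OF finite_subset[OF C(1) V] C(1,2)] by blast
  have finC: "finite C" using C(1) V by (rule finite_subset)
  then have finA: "finite A" using A(1) finite_subset by blast
  have "wdeg A t \<le> wdeg C t" unfolding wdeg_def by (rule sum_mono2[OF finC A(1)]) simp
  then have At: "wdeg A t < s" using C(3) by simp
  \<comment> \<open>If some \<open>r \<in> P\<close> had a term of weight zero on \<open>A\<close>,
    then \<open>r * f\<close> would have a term of weight below \<open>s\<close>, impossible in the
    \<open>s\<close>-th power.\<close>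
  have PA: "P \<subseteq> var_prime V A"
  proof (rule subsetI, rule ccontr)
    fix r assume r: "r \<in> P" "r \<notin> var_prime V A"
    then obtain a where a: "a \<in> keys r" "wdeg A a = 0"
      using P.Icarr[OF r(1)] unfolding mem_var_prime[OF finA] by auto
    obtain b where b: "b \<in> keys (r * f)" "wdeg A b \<le> wdeg A a + wdeg A t"
      by (rule key_mult_wdeg[OF a(1) t(1)])
    have "b \<in> multiples (ksum T s)" using r(1) b(1) f(2) by (auto simp: mem_mideal)
    then have "s \<le> wdeg A b" using finA A(2) by (intro wdeg_multiples_ksum) (auto simp: min_cover_def)
    then show False using a(2) b(2) At by simp
  qed
  define B where "B = {i \<in> V. xpow (evar i) \<in> P}"
  \<comment> \<open>A prime ideal containing a monomial contains one of its variables, by splitting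
    off one variable at a time.\<close>
  have prime_pow: "\<exists>i\<in>keys e. i \<in> B" if "keys e \<subseteq> V" "xpow e \<in> P" for e
    using that
  proof (induction "wdeg V e" arbitrary: e rule: less_induct)
    case less
    have "e \<noteq> 0"
    proof
      assume "e = 0"
      then have "1 \<in> P" using less.prems by simp
      then show False using P.one_imp_carrier P.I_notcarr by simp
    qed
    then obtain i where i: "lookup e i > 0" by (metis gr0I lookup_zero poly_mapping_eqI)
    then have iV: "i \<in> keys e" "i \<in> V" using less.prems(1) by (auto simp: in_keys_iff)
    have e: "e = e - evar i + evar i" using i
      by (intro poly_mapping_eqI) (auto simp: lookup_add lookup_minus lookup_single when_def)
    have sub: "keys (e - evar i) \<subseteq> keys e" by (auto simp: in_keys_iff lookup_minus)
    have "wdeg V (evar i) > 0" using iV(2) by (subst wdeg_pos[OF V]) (auto intro: bexI[of _ i])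
    then have less': "wdeg V (e - evar i) < wdeg V e" by (subst (2) e) (simp add: wdeg_add)
    have "xpow (e - evar i) * xpow (evar i) = (xpow e :: 'k mpoly)" using e by (simp add: mult_single)
    then have "xpow (e - evar i) \<otimes>\<^bsub>poly_ring V\<^esub> xpow (evar i) \<in> P" using less.prems(2) by simp
    then have "xpow (e - evar i) \<in> P \<or> xpow (evar i) \<in> P"
      using P.I_prime sub less.prems(1) iV(2) by auto
    then show ?case using less.hyps[OF less'] sub less.prems(1) iV by (auto simp: B_def)
  qed
  \<comment> \<open>Since \<open>P\<close> contains the \<open>s\<close>-th power, it contains a
    monomial supported inside each generator.\<close>
  have "cover T B"
    unfolding cover_def
  proof
    fix e assume e: "e \<in> T"
    obtain r where r: "r \<in> ksum T s" "keys r \<subseteq> keys e" using ksum_keys_subset[OF e] by blast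
    have rV: "keys r \<subseteq> V" using r(2) TV e by blast
    then have "xpow r \<in> (mideal V (ksum T s) :: 'k mpoly set)"
      using r(1) subsetD[OF subset_multiples] by (auto simp: xpow_mem_mideal)
    then have "xpow r \<in> P"
      using f rV mult_l_mem_mideal[of "xpow r" V "ksum T s" f] by (simp add: mult.commute)
    then obtain i where "i \<in> keys r" "i \<in> B" using prime_pow[OF rV] by blast
    moreover have "i \<in> keys e" using \<open>i \<in> keys r\<close> r(2) by blast
    ultimately show "\<exists>i\<in>B. lookup e i > 0" by (intro bexI[of _ i]) (simp_all add: in_keys_iff)
  qed
  moreover have "B \<subseteq> A"
  proof
    fix i assume "i \<in> B"
    then have i: "i \<in> V" "xpow (evar i) \<in> P" by (auto simp: B_def)
    then have "evar i \<in> multiples (evar ` A)" using PA by (auto simp: xpow_mem_mideal dest: subsetD)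
    then show "i \<in> A" by (auto simp: multiples_evar lookup_single when_def split: if_splits)
  qed
  ultimately have "B = A" using A(2) by (auto simp: min_cover_def)
  have AV: "A \<subseteq> V" using A(2) by (simp add: min_cover_def)
  have "var_prime V A = Idl\<^bsub>poly_ring V\<^esub> (xpow ` evar ` A :: 'k mpoly set)"
    using AV by (intro Idl_xpow[symmetric]) auto
  also have "\<dots> \<subseteq> P"
    using \<open>B = A\<close> by (intro ring.genideal_minimal[OF poly_ring_ring P.is_ideal]) (auto simp: B_def)
  finally have "P = var_prime V A" using PA by blast
  then show ?thesis using that A(2) by blast
qed

text \<open>The witness is the product of the variables outside \<open>A\<close>: a private
  generator of \<open>i\<close>, being square-free, divides it once \<open>x_i\<close> is
  adjoined.\<close>

lemma min_cover_assoc_at: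
  assumes "finite V" "squarefree_exps V T" "min_cover V T A"
  obtains u where "assoc_at V T A u"
proof
  define u where "u = (\<Sum>i\<in>V - A. evar i)"
  have u: "lookup u i = (if i \<in> V - A then 1 else 0)" for i
    using assms(1) by (simp add: u_def lookup_sum lookup_single when_def)
  have "u + evar i \<in> multiples T" if i: "i \<in> A" for i
  proof -
    obtain e where e: "e \<in> T" "lookup e i > 0" "\<And>k. k \<in> A \<Longrightarrow> k \<noteq> i \<Longrightarrow> lookup e k = 0"
      using min_cover_private[OF assms(3) i] by blast
    have "lookup e k \<le> 1" "k \<notin> V \<Longrightarrow> lookup e k = 0" for k
      using assms(2) e(1) by (auto simp: squarefree_exps_def intro: lookup_eq_0_outside)
    then show ?thesis using e i
      by (intro multiplesI[OF e(1)]) (auto simp: lookup_add u lookup_single when_def)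
  qed
  moreover have "u + r \<notin> multiples T" if r: "keys r \<subseteq> V - A" for r
  proof
    assume "u + r \<in> multiples T"
    then obtain g where g: "g \<in> T" "\<And>i. lookup g i \<le> lookup (u + r) i" by (auto simp: multiples_def)
    then obtain i where i: "i \<in> A" "lookup g i > 0"
      using assms(3) unfolding min_cover_def cover_def by blast
    have "lookup r i = 0" using r i(1) by (intro lookup_eq_0_outside[OF r]) simp
    then show False using g(2)[of i] i by (simp add: lookup_add u)
  qed
  ultimately show "assoc_at V T A u"
    using assms(3) by (auto simp: assoc_at_def min_cover_def in_keys_iff u split: if_splits)
qed

text \<open>Agreement makes every associated prime of a power minimal over the ideal, and such
  primes are already associated to the ideal itself.\<close>

lemma normally_torsion_free_mideal:
  assumes V: "finite V" and T: "squarefree_exps V T" and agree: "\<And>s. s \<ge> 1 \<Longrightarrow> powers_agree V T s"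
  shows "normally_torsion_free (poly_ring V) (mideal V T :: 'k::field mpoly set)"
  unfolding normally_torsion_free_def
proof (intro allI impI subsetI)
  fix k :: nat and P :: "'k mpoly set"
  assume k: "1 \<le> k" and P: "P \<in> Ass (poly_ring V) (ideal_power (poly_ring V) (mideal V T) k)"
  have TV: "\<forall>t\<in>T. keys t \<subseteq> V" using T by (auto simp: squarefree_exps_def)
  have "P \<in> Ass (poly_ring V) (mideal V (ksum T k))" using P by (simp add: ideal_power_mideal[OF TV])
  then obtain A where A: "min_cover V T A" "P = var_prime V A"
    by (rule Ass_ksum_min_cover[OF V T agree[OF k]])
  obtain u where "assoc_at V T A u" by (rule min_cover_assoc_at[OF V T A(1)])
  then show "P \<in> Ass (poly_ring V) (mideal V T)" unfolding A(2) by (rule assoc_at_imp_Ass[OF V])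
qed

text \<open>Multiplying \<open>f\<close> by a variable shifts its terms without cancellation, so any
  term of \<open>f\<close> outside the ideal is a socle monomial.\<close>

lemma socle_monomial:
  assumes "finite V" and Ass: "(var_prime V V :: 'k::field mpoly set) \<in> Ass (poly_ring V) (mideal V T)"
  obtains t where "assoc_at V T V t"
proof -
  obtain f :: "'k mpoly" where f: "f \<in> carrier (poly_ring V)"
      "var_prime V V = {r \<in> carrier (poly_ring V). r * f \<in> mideal V T}"
    using Ass unfolding Ass_mideal_iff by blast
  have "1 \<notin> (var_prime V V :: 'k mpoly set)" by (simp add: mem_mideal multiples_evar)
  then have "f \<notin> mideal V T" unfolding f(2) by simp
  then obtain t where t: "t \<in> keys f" "t \<notin> multiples T" using f(1) by (auto simp: mem_mideal)
  have "t + evar i \<in> multiples T" if i: "i \<in> V" for i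
  proof -
    have "xpow (evar i) \<in> (var_prime V V :: 'k mpoly set)" using i by (simp add: mem_mideal multiples_evar)
    then have "xpow (evar i) * f \<in> mideal V T" unfolding f(2) by blast
    moreover have "evar i + t \<in> keys (xpow (evar i) * f)" by (rule key_mult_unique) (use t in auto)
    ultimately show ?thesis by (auto simp: mem_mideal add.commute)
  qed
  moreover have "r = 0" if "keys r \<subseteq> V - V" for r :: "nat \<Rightarrow>\<^sub>0 nat"
    using that by (intro poly_mapping_eqI) (auto simp: in_keys_iff)
  ultimately have "assoc_at V T V t" using t f(1) by (fastforce simp: assoc_at_def)
  then show ?thesis by (rule that)
qed

section \<open>Minimal generators and minors\<close>

definition min_exps :: "(nat \<Rightarrow>\<^sub>0 nat) set \<Rightarrow> (nat \<Rightarrow>\<^sub>0 nat) set" where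
  "min_exps T = {t \<in> T. \<forall>g\<in>T. (\<forall>i. lookup g i \<le> lookup t i) \<longrightarrow> g = t}"

lemma min_exps_subset: "min_exps T \<subseteq> T"
  by (auto simp: min_exps_def)

lemma exists_min_exp:
  assumes "t \<in> T"
  shows "\<exists>g\<in>min_exps T. \<forall>i. lookup g i \<le> lookup t i"
  using assms
proof (induction "wdeg (keys t) t" arbitrary: t rule: less_induct)
  case less
  show ?case
  proof (cases "t \<in> min_exps T")
    case False
    then obtain g where g: "g \<in> T" "\<And>i. lookup g i \<le> lookup t i" "g \<noteq> t"
      using less.prems by (auto simp: min_exps_def)
    then obtain i where i: "lookup g i \<noteq> lookup t i" by (meson poly_mapping_eqI)
    then have lt: "lookup g i < lookup t i" using g(2)[of i] by simp
    have "keys g \<subseteq> keys t" using g(2) by (auto simp: in_keys_iff) (metis le_zero_eq not_gr_zero)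
    then have "wdeg (keys g) g \<le> wdeg (keys t) g" unfolding wdeg_def by (intro sum_mono2) auto
    also have "\<dots> < wdeg (keys t) t" unfolding wdeg_def
      using g(2) lt by (intro sum_strict_mono_ex1) (auto simp: in_keys_iff intro!: bexI[of _ i])
    finally obtain h where "h \<in> min_exps T" "\<forall>i. lookup h i \<le> lookup g i"
      using less.hyps[of g] g(1) by blast
    then show ?thesis using g(2) by (meson order_trans)
  qed auto
qed

lemma multiples_min_exps: "multiples (min_exps T) = multiples T"
proof
  show "multiples (min_exps T) \<subseteq> multiples T" by (auto simp: multiples_def min_exps_def)
  show "multiples T \<subseteq> multiples (min_exps T)"
    using exists_min_exp by (intro multiples_subset) (force simp: multiples_def)
qed

text \<open>Settles the definite description: the divisibility-minimal exponents generate
  irredundantly and occur in every monomial generating set.\<close>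

lemma min_gens_mideal:
  assumes T: "\<forall>t\<in>T. keys t \<subseteq> V"
  shows "min_gens V (mideal V T :: 'k::field mpoly set) = xpow ` min_exps T"
  unfolding min_gens_def
proof (rule the_equality)
  have mono: "\<exists>S. H = xpow ` S \<and> (\<forall>t\<in>S. keys t \<subseteq> V)" if "H \<subseteq> monomials V" for H :: "'k mpoly set"
    using that by (intro exI[of _ "{t. keys t \<subseteq> V \<and> xpow t \<in> H}"]) (auto simp: monomials_def)
  have mem: "multiples S \<inter> {t. keys t \<subseteq> V} = multiples S' \<inter> {t. keys t \<subseteq> V}"
    if "mideal V S = (mideal V S' :: 'k mpoly set)" for S S'
    using that xpow_mem_mideal[where ?'k = 'k] by blast
  have MV: "\<forall>t\<in>min_exps T. keys t \<subseteq> V" using T min_exps_subset by blast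
  have IdlM: "Idl\<^bsub>poly_ring V\<^esub> (xpow ` min_exps T) = (mideal V T :: 'k mpoly set)"
    by (simp add: Idl_xpow[OF MV] mideal_cong[OF multiples_min_exps])
  have minimal: "Idl\<^bsub>poly_ring V\<^esub> H \<noteq> mideal V T" if H: "H \<subset> xpow ` min_exps T" for H :: "'k mpoly set"
  proof
    assume eq: "Idl\<^bsub>poly_ring V\<^esub> H = mideal V T"
    have "H \<subseteq> monomials V" using H MV by (fastforce simp: monomials_def)
    then obtain S where S: "H = xpow ` S" "\<forall>t\<in>S. keys t \<subseteq> V" using mono by blast
    have "S \<subset> min_exps T" using H unfolding S(1) by auto
    then obtain t where t: "t \<in> min_exps T" "t \<notin> S" "S \<subseteq> T" using min_exps_subset by blast
    have "mideal V S = (mideal V T :: 'k mpoly set)" using eq by (simp add: S(1) Idl_xpow[OF S(2)])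
    moreover have "t \<in> multiples T" using t(1) min_exps_subset subset_multiples by blast
    ultimately have "t \<in> multiples S" using mem[of S T] MV t(1) by blast
    then obtain g where "g \<in> S" "\<forall>i. lookup g i \<le> lookup t i" by (auto simp: multiples_def)
    then show False using t by (auto simp: min_exps_def)
  qed
  have sub: "xpow ` min_exps T \<subseteq> (monomials V :: 'k mpoly set)"
    using MV by (auto simp: monomials_def)
  show "xpow ` min_exps T \<subseteq> (monomials V :: 'k mpoly set) \<and>
      Idl\<^bsub>poly_ring V\<^esub> (xpow ` min_exps T) = (mideal V T :: 'k mpoly set) \<and>
      (\<forall>H. H \<subset> xpow ` min_exps T \<longrightarrow> Idl\<^bsub>poly_ring V\<^esub> H \<noteq> (mideal V T :: 'k mpoly set))"
    by (intro conjI allI impI sub IdlM minimal)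
  fix G :: "'k mpoly set"
  assume "G \<subseteq> monomials V \<and> Idl\<^bsub>poly_ring V\<^esub> G = mideal V T \<and>
      (\<forall>H. H \<subset> G \<longrightarrow> Idl\<^bsub>poly_ring V\<^esub> H \<noteq> mideal V T)"
  then have G: "G \<subseteq> monomials V" "Idl\<^bsub>poly_ring V\<^esub> G = mideal V T"
      "\<And>H. H \<subset> G \<Longrightarrow> Idl\<^bsub>poly_ring V\<^esub> H \<noteq> mideal V T"
    by simp_all
  obtain S where S: "G = xpow ` S" "\<forall>t\<in>S. keys t \<subseteq> V" using mono[OF G(1)] by blast
  have "mideal V S = (mideal V T :: 'k mpoly set)" using G(2) by (simp add: S(1) Idl_xpow[OF S(2)])
  note mult = mem[OF this]
  have "min_exps T \<subseteq> S"
  proof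
    fix t assume t: "t \<in> min_exps T"
    then have "t \<in> multiples T" using min_exps_subset subset_multiples by blast
    then have "t \<in> multiples S" using mult MV t by blast
    then obtain g where g: "g \<in> S" "\<And>i. lookup g i \<le> lookup t i" by (auto simp: multiples_def)
    \<comment> \<open>\<open>g\<close> divides \<open>t\<close> and some \<open>h \<in> T\<close>
      divides \<open>g\<close>; minimality of \<open>t\<close> forces all three to be equal.\<close>
    have "g \<in> multiples T" using mult S(2) g(1) subset_multiples by blast
    then obtain h where h: "h \<in> T" "\<And>i. lookup h i \<le> lookup g i" by (auto simp: multiples_def)
    have "h = t" using t h g(2) unfolding min_exps_def by (blast intro: order_trans)
    then have "g = t" using h(2) g(2) by (intro poly_mapping_eqI antisym) auto
    then show "t \<in> S" using g(1) by simp
  qed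
  then have "xpow ` min_exps T \<subseteq> G" unfolding S(1) by blast
  then show "G = xpow ` min_exps T" using G(3)[of "xpow ` min_exps T"] IdlM by blast
qed

section \<open>Deletion and contraction on exponents\<close>

lemma subst_var_xpow:
  "subst_var j c (xpow t) = single (Poly_Mapping.update j 0 t) (c ^ lookup t j)"
  by (simp add: subst_var_def)

lemma reset_eq_self: "lookup t j = 0 \<Longrightarrow> Poly_Mapping.update j 0 t = t"
  by (rule poly_mapping_eqI) (simp add: lookup_reset)

text \<open>Any monomial generating set may replace the minimal one, so the formula applies to
  powers: a generator dividing one without \<open>x_j\<close> itself lacks
  \<open>x_j\<close>.\<close>

lemma deletion_mideal:
  assumes T: "\<forall>t\<in>T. keys t \<subseteq> V"
  shows "deletion V j (mideal V T) = (mideal (V - {j}) {t \<in> T. lookup t j = 0} :: 'k::field mpoly set)"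
proof -
  define M where "M = {t \<in> min_exps T. lookup t j = 0}"
  have subst: "subst_var j 0 (xpow t) = (if lookup t j = 0 then xpow t else 0 :: 'k mpoly)" for t
    by (simp add: subst_var_xpow reset_eq_self zero_power)
  have "deletion V j (mideal V T) = (mideal (V - {j}) M :: 'k mpoly set)"
    unfolding deletion_def min_gens_mideal[OF T] image_image subst
  proof (rule Idl_monomials)
    show "\<forall>t\<in>M. keys t \<subseteq> V - {j}"
      using T min_exps_subset[of T] by (auto simp: M_def in_keys_iff)
  qed (auto simp: M_def)
  also have "\<dots> = mideal (V - {j}) {t \<in> T. lookup t j = 0}"
  proof (rule mideal_cong, rule antisym)
    show "multiples M \<subseteq> multiples {t \<in> T. lookup t j = 0}"
      using min_exps_subset[of T] by (auto simp: multiples_def M_def)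
    show "multiples {t \<in> T. lookup t j = 0} \<subseteq> multiples M"
    proof (intro multiples_subset subsetI)
      fix t assume t: "t \<in> {t \<in> T. lookup t j = 0}"
      then obtain g where g: "g \<in> min_exps T" "\<forall>i. lookup g i \<le> lookup t i"
        using exists_min_exp by blast
      then have "lookup g j = 0" using t g(2)[rule_format, of j] by simp
      then show "t \<in> multiples M" using g by (auto simp: multiples_def M_def)
    qed
  qed
  finally show ?thesis .
qed

text \<open>Here too any monomial generating set will do, since setting \<open>x_j = 1\<close>
  preserves divisibility.\<close>

lemma contraction_mideal:
  assumes T: "\<forall>t\<in>T. keys t \<subseteq> V"
  shows "contraction V j (mideal V T) =
    (mideal (V - {j}) (Poly_Mapping.update j 0 ` T) :: 'k::field mpoly set)"
proof -
  have "contraction V j (mideal V T) =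
      Idl\<^bsub>poly_ring (V - {j})\<^esub> (xpow ` Poly_Mapping.update j 0 ` min_exps T :: 'k mpoly set)"
    by (simp add: contraction_def min_gens_mideal[OF T] image_image subst_var_xpow)
  also have "\<dots> = mideal (V - {j}) (Poly_Mapping.update j 0 ` min_exps T)"
    using T min_exps_subset[of T] by (intro Idl_xpow) (auto simp: keys_reset)
  also have "\<dots> = mideal (V - {j}) (Poly_Mapping.update j 0 ` T)"
  proof (rule mideal_cong, rule antisym)
    show "multiples (Poly_Mapping.update j 0 ` min_exps T) \<subseteq> multiples (Poly_Mapping.update j 0 ` T)"
      using min_exps_subset[of T] by (auto simp: multiples_def)
    show "multiples (Poly_Mapping.update j 0 ` T) \<subseteq> multiples (Poly_Mapping.update j 0 ` min_exps T)"
    proof (intro multiples_subset subsetI)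
      fix t assume "t \<in> Poly_Mapping.update j 0 ` T"
      then obtain t' where t': "t' \<in> multiples T" "t = Poly_Mapping.update j 0 t'"
        using subset_multiples by blast
      show "t \<in> multiples (Poly_Mapping.update j 0 ` min_exps T)"
        by (rule multiples_imp_reset[of t'])
          (use t' in \<open>simp_all add: multiples_min_exps lookup_reset\<close>)
    qed
  qed
  finally show ?thesis .
qed

lemma irrelevant_ideal_eq: "irrelevant_ideal V = (var_prime V V :: 'k::field mpoly set)"
proof -
  have "pvar ` V = (xpow ` evar ` V :: 'k mpoly set)" by (auto simp: pvar_def evar_def image_image)
  then show ?thesis unfolding irrelevant_ideal_def by (simp only:) (rule Idl_xpow, auto)
qed

lemma deletion_var_prime: "deletion V j (var_prime V V) = (var_prime (V - {j}) (V - {j}) :: 'k::field mpoly set)"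
proof -
  have "{t \<in> evar ` V. lookup t j = 0} = evar ` (V - {j})" by auto
  then show ?thesis using deletion_mideal[of "evar ` V" V j] by auto
qed

lemma squarefree_monomial_idealE:
  assumes "squarefree_monomial_ideal V (J :: 'k::field mpoly set)"
  obtains T where "squarefree_exps V T" "J = mideal V T"
proof -
  obtain S :: "'k mpoly set" where S: "S \<subseteq> squarefree_monomials V" "J = Idl\<^bsub>poly_ring V\<^esub> S"
    using assms by (auto simp: squarefree_monomial_ideal_def)
  define T where "T = {t. keys t \<subseteq> V \<and> (\<forall>i. lookup t i \<le> 1) \<and> (xpow t :: 'k mpoly) \<in> S}"
  have "S = xpow ` T" using S(1) by (auto simp: T_def squarefree_monomials_def)
  moreover have "squarefree_exps V T" by (auto simp: T_def squarefree_exps_def)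
  moreover have "Idl\<^bsub>poly_ring V\<^esub> (xpow ` T) = (mideal V T :: 'k mpoly set)"
    by (rule Idl_xpow) (simp add: T_def)
  ultimately show ?thesis using that S(2) by blast
qed

section \<open>Coprime monomials and independent sets\<close>

lemma coprime_monomials:
  assumes "keys a \<subseteq> V" "keys b \<subseteq> V"
    and gcd: "\<one>\<^bsub>poly_ring V\<^esub> gcdof\<^bsub>poly_ring V\<^esub> (xpow a :: 'k::field mpoly) (xpow b)"
  shows "keys a \<inter> keys b = {}"
proof (rule ccontr)
  assume "keys a \<inter> keys b \<noteq> {}"
  then obtain i where i: "i \<in> keys a" "i \<in> keys b" by blast
  have dvd: "(xpow (evar i) :: 'k mpoly) divides\<^bsub>poly_ring V\<^esub> xpow c" if c: "i \<in> keys c" "keys c \<subseteq> V" for c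
  proof -
    have "c = evar i + (c - evar i)" using c(1)
      by (intro poly_mapping_eqI) (auto simp: lookup_add lookup_minus in_keys_iff)
    then have "(xpow c :: 'k mpoly) = xpow (evar i) * xpow (c - evar i)" by (simp add: mult_single)
    moreover have "keys (c - evar i) \<subseteq> V" using c(2) by (auto simp: in_keys_iff lookup_minus)
    ultimately show ?thesis unfolding factor_def by (intro bexI[of _ "xpow (c - evar i)"]) auto
  qed
  \<comment> \<open>A shared variable is a common divisor, so it would divide the gcd
    \<open>1\<close>; but no multiple of a variable has a constant term.\<close>
  have "i \<in> V" using i(1) assms(1) by blast
  then have "(xpow (evar i) :: 'k mpoly) divides\<^bsub>poly_ring V\<^esub> \<one>\<^bsub>poly_ring V\<^esub>"
    using gcd dvd i assms(1,2) unfolding isgcd_def by auto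
  then obtain q :: "'k mpoly" where "1 = xpow (evar i) * q" by (auto simp: factor_def)
  then have "0 \<in> keys (xpow (evar i) * q)" by (metis keys_one singletonI)
  then obtain x y :: "nat \<Rightarrow>\<^sub>0 nat" where "0 = x + y" "x = evar i" by (auto elim!: keys_multE)
  then have "lookup (evar i) i = 0" by (metis add_is_0 lookup_add lookup_zero)
  then show False by simp
qed

text \<open>
  A monomial of the socle that is divisible by every variable is divisible by the product of any
  independent set, and that product lies in the power of \<open>I\<close> given by its cardinality.
\<close>

lemma card_independent_set_less:
  assumes V: "finite V" and T: "squarefree_exps V T"
    and \<Gamma>: "independent_set V (mideal V T :: 'k::field mpoly set) \<Gamma>"
    and t: "t \<notin> multiples (ksum T s)" "\<And>i. i \<in> V \<Longrightarrow> lookup t i > 0"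
  shows "card \<Gamma> < s"
proof (rule ccontr)
  assume s: "\<not> card \<Gamma> < s"
  have TV: "\<forall>t\<in>T. keys t \<subseteq> V" using T by (auto simp: squarefree_exps_def)
  \<comment> \<open>Exactly \<open>s\<close> members are kept, so that their product lies in the
    \<open>s\<close>-th power.\<close>
  obtain \<Gamma>' where \<Gamma>': "\<Gamma>' \<subseteq> \<Gamma>" "card \<Gamma>' = s" "finite \<Gamma>'"
    using obtain_subset_with_card_n[of s \<Gamma>] s by auto
  define E where "E = {e \<in> min_exps T. (xpow e :: 'k mpoly) \<in> \<Gamma>'}"
  have "\<Gamma>' \<subseteq> xpow ` min_exps T"
    using \<Gamma> \<Gamma>'(1) min_gens_mideal[OF TV, where ?'k = 'k] by (auto simp: independent_set_def)
  then have E: "\<Gamma>' = xpow ` E" by (auto simp: E_def)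
  have inj: "inj_on (xpow :: _ \<Rightarrow> 'k mpoly) E" by (rule inj_onI) simp
  have finE: "finite E" "card E = s"
    using \<Gamma>'(2,3) E inj by (simp_all add: card_image finite_image_iff)
  have ET: "E \<subseteq> T" using min_exps_subset by (auto simp: E_def)
  have disj: "keys a \<inter> keys b = {}" if "a \<in> E" "b \<in> E" "a \<noteq> b" for a b
  proof (rule coprime_monomials[where ?'k = 'k])
    show "keys a \<subseteq> V" "keys b \<subseteq> V" using that ET TV by auto
    have "(xpow a :: 'k mpoly) \<noteq> xpow b" "(xpow a :: 'k mpoly) \<in> \<Gamma>" "(xpow b :: 'k mpoly) \<in> \<Gamma>"
      using that \<Gamma>'(1) by (auto simp: E_def)
    then show "\<one>\<^bsub>poly_ring V\<^esub> gcdof\<^bsub>poly_ring V\<^esub> (xpow a :: 'k mpoly) (xpow b)"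
      using \<Gamma> unfolding independent_set_def by blast
  qed
  have "sum id F \<in> ksum T (card F)" if "finite F" "F \<subseteq> E" for F
    using that
  proof (induction F rule: finite_induct)
    case (insert e F)
    then show ?case using ET by (auto simp: add.commute[of e])
  qed simp
  then have "sum id E \<in> ksum T s" using finE by auto
  moreover have "lookup (sum id E) i \<le> lookup t i" for i
  \<comment> \<open>Disjoint supports allow at most one member to involve \<open>x_i\<close>, and
    its exponent there is at most one.\<close>
  proof (cases "\<exists>e\<in>E. lookup e i > 0")
    case True
    then obtain e where e: "e \<in> E" "lookup e i > 0" by blast
    have "lookup e' i = 0" if "e' \<in> E - {e}" for e'
      using disj[of e' e] that e by (auto simp: in_keys_iff)
    then have "lookup (sum id E) i = lookup e i"
      unfolding lookup_sum id_def using finE(1) e(1) by (simp add: sum.remove)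
    also have "\<dots> \<le> 1" using e(1) ET T by (auto simp: squarefree_exps_def)
    also have "i \<in> V" using e ET TV by (force simp: in_keys_iff)
    then have "1 \<le> lookup t i" using t(2)[of i] by simp
    finally show ?thesis .
  qed (simp add: lookup_sum)
  ultimately show False using t(1) by (auto simp: multiples_def)
qed

text \<open>The invariant for induction along minors: it survives each further step and implies
  normal torsion-freeness.\<close>

definition symbolic_minor :: "nat set \<times> 'k::field mpoly set \<Rightarrow> bool" where
  "symbolic_minor WL \<longleftrightarrow> finite (fst WL) \<and> (\<exists>T. squarefree_exps (fst WL) T \<and>
     snd WL = mideal (fst WL) T \<and> (\<forall>s. powers_agree (fst WL) T s))"

lemma symbolic_minor_normally_torsion_free:
  "symbolic_minor (W, L) \<Longrightarrow> normally_torsion_free (poly_ring W) L"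
  unfolding symbolic_minor_def using normally_torsion_free_mideal by auto

lemma minor_step_cases:
  assumes "minor_step (V, mideal V T) M" "squarefree_exps V T"
  obtains j U where "j \<in> V" "M = (V - {j}, mideal (V - {j}) U)"
    "U = {t \<in> T. lookup t j = 0} \<or> U = Poly_Mapping.update j 0 ` T"
proof -
  have TV: "\<forall>t\<in>T. keys t \<subseteq> V" using assms(2) by (auto simp: squarefree_exps_def)
  show ?thesis using assms(1)
  proof cases
    case (delete j)
    then show ?thesis using that[of j] by (simp add: deletion_mideal[OF TV])
  next
    case (contract j)
    then show ?thesis using that[of j] by (simp add: contraction_mideal[OF TV])
  qed
qed

lemma symbolic_minor_step:
  assumes "minor_step M N" "symbolic_minor M"
  shows "symbolic_minor N"
proof -
  obtain V J where M: "M = (V, J)" by (cases M)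
  obtain T where T: "finite V" "squarefree_exps V T" "J = mideal V T" "\<And>s. powers_agree V T s"
    using assms(2) by (auto simp: M symbolic_minor_def)
  have "minor_step (V, mideal V T) N" using assms(1) M T(3) by simp
  then obtain j U where j: "j \<in> V" "N = (V - {j}, mideal (V - {j}) U)"
      and U: "U = {t \<in> T. lookup t j = 0} \<or> U = Poly_Mapping.update j 0 ` T"
    using T(2) by (rule minor_step_cases)
  have "squarefree_exps (V - {j}) U" "powers_agree (V - {j}) U s" for s
    using U squarefree_exps_delete[OF T(2)] squarefree_exps_reset[OF T(2)]
      powers_agree_delete[OF T(4)] powers_agree_reset[OF T(1,4) j(1)] by auto
  then show ?thesis using T(1) by (auto simp: symbolic_minor_def j(2))
qed

theorem proposition3p6:
  fixes n m :: nat
    and I :: "'k::field mpoly set"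
  assumes "n \<ge> 1"
    and "squarefree_monomial_ideal {1..n} I"
    and "m \<ge> 1"
    and "\<And>s. 1 \<le> s \<Longrightarrow> s \<le> m \<Longrightarrow>
           Ass (poly_ring {1..n}) (ideal_power (poly_ring {1..n}) I s) =
           Min_primes (poly_ring {1..n}) I"
    and "\<And>s. s \<ge> m + 1 \<Longrightarrow>
           Ass (poly_ring {1..n}) (ideal_power (poly_ring {1..n}) I s) =
           Min_primes (poly_ring {1..n}) I \<union> {irrelevant_ideal {1..n}}"
    and "\<And>s j. s \<ge> m + 1 \<Longrightarrow> j \<in> {1..n} \<Longrightarrow>
           deletion {1..n} j (irrelevant_ideal {1..n}) \<notin>
           Ass (poly_ring ({1..n} - {j}))
             (deletion {1..n} j (ideal_power (poly_ring {1..n}) I s))"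
  shows "minimally_not_ntf {1..n} I \<and> m \<ge> beta1 {1..n} I"
proof -
  define V where "V = {1..n}"
  have V: "finite V" by (simp add: V_def)
  obtain T where T: "squarefree_exps V T" and I: "I = mideal V T"
    using assms(2) unfolding V_def by (rule squarefree_monomial_idealE)
  have TV: "\<forall>t\<in>T. keys t \<subseteq> V" using T by (auto simp: squarefree_exps_def)
  have power: "ideal_power (poly_ring V) I s = mideal V (ksum T s)" for s
    unfolding I by (rule ideal_power_mideal[OF TV])
  have Ass_low: "Ass (poly_ring V) (mideal V (ksum T s)) = Min_primes (poly_ring V) I"
    if "1 \<le> s" "s \<le> m" for s
    using assms(4)[OF that] power by (simp add: V_def)
  have Ass_high: "Ass (poly_ring V) (mideal V (ksum T s)) = Min_primes (poly_ring V) I \<union> {var_prime V V}"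
    if "s \<ge> m + 1" for s
    using assms(5)[OF that] power by (simp add: V_def irrelevant_ideal_eq)
  \<comment> \<open>The hypothesis on deletions, in terms of exponents: deleting \<open>x_j\<close>
    from \<open>I^s\<close> gives the \<open>s\<close>-th power of the deletion.\<close>
  have del: "\<not> assoc_at (V - {j}) (ksum {t \<in> T. lookup t j = 0} s) (V - {j}) u"
    if s: "s \<ge> m + 1" and j: "j \<in> V" for s j u
  proof
    assume "assoc_at (V - {j}) (ksum {t \<in> T. lookup t j = 0} s) (V - {j}) u"
    then have "(var_prime (V - {j}) (V - {j}) :: 'k mpoly set) \<in>
        Ass (poly_ring (V - {j})) (mideal (V - {j}) (ksum {t \<in> T. lookup t j = 0} s))"
      using V by (intro assoc_at_imp_Ass) auto
    moreover have "deletion V j (mideal V (ksum T s)) =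
        (mideal (V - {j}) (ksum {t \<in> T. lookup t j = 0} s) :: 'k mpoly set)"
      by (simp add: deletion_mideal[OF ksum_keys[OF TV]] ksum_nolookup)
    ultimately show False using assms(6)[OF s, of j] j power[of s]
      by (simp add: V_def irrelevant_ideal_eq deletion_var_prime)
  qed
  \<comment> \<open>The only non-minimal associated prime that the hypotheses allow is the maximal
    ideal, and only beyond \<open>m\<close>.\<close>
  have min_cover: "min_cover V T A" if "assoc_at V (ksum T s) A u" "1 \<le> s" "s \<le> m \<or> A \<noteq> V" for s A u
  proof (rule Min_primes_min_cover[OF V TV, where ?'k = 'k])
    show A: "A \<subseteq> V" using that(1) by (simp add: assoc_at_def)
    have "A = V" if "(var_prime V A :: 'k mpoly set) = var_prime V V"
      using that var_prime_subset_iff[of V V A, where ?'k = 'k] A by blast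
    then show "(var_prime V A :: 'k mpoly set) \<in> Min_primes (poly_ring V) (mideal V T)"
      using assoc_at_imp_Ass[OF V that(1), where ?'k = 'k] that(2,3) Ass_low[of s] Ass_high[of s]
      unfolding I by (cases "s \<le> m") auto
  qed
  have agree0: "powers_agree V T s" if "s \<le> m" for s
  proof (cases "s = 0")
    case True
    then show ?thesis by (simp add: powers_agree_def multiples_def)
  next
    case False
    then show ?thesis using that by (intro powers_agreeI[OF V T] min_cover[of s]) auto
  qed
  \<comment> \<open>Valid beyond \<open>m\<close> as well: a prime of the contraction avoids
    \<open>x_k\<close>, so its lift to \<open>I^s\<close> is not the maximal ideal and must be
    minimal.\<close>
  have agree_contract: "powers_agree (V - {k}) (Poly_Mapping.update k 0 ` T) s" if k: "k \<in> V" for k s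
  proof (cases "s = 0")
    case True
    then show ?thesis by (simp add: powers_agree_def multiples_def)
  next
    case False
    show ?thesis
    proof (rule powers_agreeI)
      fix A u assume *: "assoc_at (V - {k}) (ksum (Poly_Mapping.update k 0 ` T) s) A u"
      then have A: "A \<subseteq> V - {k}" by (simp add: assoc_at_def)
      have "min_cover V T A"
        by (rule min_cover[OF assoc_at_reset[OF T k *]]) (use False A k in auto)
      moreover have "cover (Poly_Mapping.update k 0 ` T) B \<longleftrightarrow> cover T B" if "B \<subseteq> A" for B
        using that A by (intro cover_reset) auto
      ultimately show "min_cover (V - {k}) (Poly_Mapping.update k 0 ` T) A"
        using A by (auto simp: min_cover_def)
    qed (use V squarefree_exps_reset[OF T] in auto)
  qed
  \<comment> \<open>Up to \<open>m\<close> this is inherited from \<open>I\<close>. Beyond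
    \<open>m\<close>, a failure gives a witness \<open>u\<close> whose prime is not maximal by
    \<open>del\<close>, which leaves some \<open>x_k\<close> outside \<open>A\<close>.\<close>
  have agree_delete: "powers_agree (V - {j}) {t \<in> T. lookup t j = 0} s" if j: "j \<in> V" for j s
  proof (cases "s \<le> m")
    case True
    then show ?thesis by (intro powers_agree_delete agree0)
  next
    case False
    let ?W = "V - {j}" and ?D = "{t \<in> T. lookup t j = 0}"
    have D: "squarefree_exps ?W ?D" by (rule squarefree_exps_delete[OF T])
    show ?thesis unfolding powers_agree_def
    proof (intro allI impI, rule ccontr)
      fix t assume t: "keys t \<subseteq> ?W" "\<forall>C\<subseteq>?W. cover ?D C \<longrightarrow> s \<le> wdeg C t" "t \<notin> multiples (ksum ?D s)"
      obtain A u where Au: "assoc_at ?W (ksum ?D s) A u" "\<And>i. lookup t i \<le> lookup u i"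
        using exists_assoc_at[OF finite_Diff[OF V] t(1,3) ksum_lookup_le[OF D]] by blast
      have "A \<noteq> ?W" using del[of s j u] False j Au(1) by auto
      then obtain k where k: "k \<in> ?W" "k \<notin> A" using Au(1) by (auto simp: assoc_at_def)
      \<comment> \<open>Localising at the prime of \<open>A\<close> inverts \<open>x\<^sub>k\<close>, so the contraction by \<open>x\<^sub>k\<close> controls \<open>u\<close>.\<close>
      let ?D' = "{t \<in> Poly_Mapping.update k 0 ` T. lookup t j = 0}"
      \<comment> \<open>Deletion at \<open>j\<close> and contraction at \<open>k\<close> commute, so
        \<open>?D'\<close> is both the contraction of \<open>?D\<close> and a deletion of a
        contraction whose powers agree.\<close>
      have D': "?D' = Poly_Mapping.update k 0 ` ?D" using k(1) by (auto simp: lookup_reset)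
      define u' where "u' = Poly_Mapping.update k 0 u"
      have "u' \<notin> multiples (ksum ?D' s)"
      proof
        assume "u' \<in> multiples (ksum ?D' s)"
        then have "u' + single k s \<in> multiples (ksum ?D s)"
          unfolding D' ksum_reset by (intro multiples_reset ksum_lookup_le[OF D])
        then have "u + single k s \<in> multiples (ksum ?D s)"
          by (rule multiples_mono) (simp add: u'_def lookup_add lookup_reset)
        moreover have "keys (single k s) \<subseteq> ?W - A" using k by auto
        ultimately show False using Au(1) by (auto simp: assoc_at_def)
      qed
      moreover have "keys u' \<subseteq> V - {k} - {j}" using Au(1) by (auto simp: u'_def keys_reset assoc_at_def)
      moreover have "powers_agree (V - {k} - {j}) ?D' s"
        using agree_contract[of k s] k(1) by (intro powers_agree_delete) auto
      ultimately have "\<not> (\<forall>C\<subseteq>V - {k} - {j}. cover ?D' C \<longrightarrow> s \<le> wdeg C u')"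
        unfolding powers_agree_def by blast
      then obtain C where C: "C \<subseteq> V - {k} - {j}" "cover ?D' C" "wdeg C u' < s"
        by (auto simp: not_le)
      \<comment> \<open>A cover avoiding \<open>k\<close> does not see the change at coordinate
        \<open>k\<close>: \<open>C\<close> covers \<open>?D\<close>, yet its weight on
        \<open>t\<close> is below \<open>s\<close>.\<close>
      have "k \<notin> C" using C(1) by blast
      then have "cover ?D C" using C(2) cover_reset[of k C ?D] unfolding D' by simp
      then have "s \<le> wdeg C t" using t(2) C(1) by blast
      also have "\<dots> \<le> wdeg C u'" using Au(2) \<open>k \<notin> C\<close>
        by (intro wdeg_mono) (auto simp: u'_def lookup_reset)
      finally show False using C(3) by simp
    qed
  qed
  \<comment> \<open>\<open>I\<close> itself does not satisfy the invariant, so the first step uses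
    \<open>agree_delete\<close> and \<open>agree_contract\<close>; later steps preserve the
    invariant.\<close>
  have "normally_torsion_free (poly_ring W) L" if minor: "minor_step\<^sup>+\<^sup>+ (V, I) (W, L)" for W L
  proof -
    have "symbolic_minor (W, L)" using minor
    proof (induction rule: tranclp_induct)
      case (base M)
      then obtain j U where j: "j \<in> V" "M = (V - {j}, mideal (V - {j}) U)"
          and U: "U = {t \<in> T. lookup t j = 0} \<or> U = Poly_Mapping.update j 0 ` T"
        unfolding I using T by (rule minor_step_cases)
      have "squarefree_exps (V - {j}) U" "powers_agree (V - {j}) U s" for s
        using U squarefree_exps_delete[OF T] squarefree_exps_reset[OF T]
          agree_delete[OF j(1)] agree_contract[OF j(1)] by auto
      then show ?case using V by (auto simp: symbolic_minor_def j(2))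
    next
      case (step M N)
      then show ?case by (blast intro: symbolic_minor_step)
    qed
    then show ?thesis by (rule symbolic_minor_normally_torsion_free)
  qed
  moreover have "\<not> normally_torsion_free (poly_ring V) I"
  proof
    assume "normally_torsion_free (poly_ring V) I"
    then have "Ass (poly_ring V) (ideal_power (poly_ring V) I (m + 1)) \<subseteq> Ass (poly_ring V) I"
      unfolding normally_torsion_free_def by (metis le_add2)
    moreover have "Ass (poly_ring V) I = Min_primes (poly_ring V) I"
      using Ass_low[of 1] assms(3) by (simp add: I)
    ultimately have "(var_prime V V :: 'k mpoly set) \<in> Min_primes (poly_ring V) (mideal V T)"
      using Ass_high[of "m + 1"] power[of "m + 1"] by (auto simp: I)
    \<comment> \<open>A minimal cover \<open>V\<close> gives each \<open>x_i\<close> a private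
      generator, necessarily \<open>x_i\<close> itself. Deleting one variable then leaves the
      maximal ideal of the smaller ring, which is associated to its own powers, against
      \<open>del\<close>.\<close>
    then have VV: "min_cover V T V" by (intro Min_primes_min_cover[OF V TV]) auto
    define j where "j = (1 :: nat)"
    have j: "j \<in> V" using assms(1) by (simp add: V_def j_def)
    let ?W = "V - {j}" and ?D = "{t \<in> T. lookup t j = 0}"
    have D: "squarefree_exps ?W ?D" by (rule squarefree_exps_delete[OF T])
    have "0 \<notin> multiples (ksum ?D (m + 1))"
    proof
      assume "0 \<in> multiples (ksum ?D (m + 1))"
      moreover have "cover ?D V" using VV by (auto simp: min_cover_def cover_def)
      ultimately have "m + 1 \<le> wdeg V 0" by (intro wdeg_multiples_ksum[OF V])
      then show False by (simp add: wdeg_def)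
    qed
    then obtain A u where Au: "assoc_at ?W (ksum ?D (m + 1)) A u"
      using exists_assoc_at[of ?W 0 "ksum ?D (m + 1)" "m + 1"] ksum_lookup_le[OF D] V by auto
    have "?W \<subseteq> A"
    proof
      fix i assume i: "i \<in> ?W"
      obtain e where e: "e \<in> T" "lookup e i > 0" "\<And>k. k \<in> V \<Longrightarrow> k \<noteq> i \<Longrightarrow> lookup e k = 0"
        using min_cover_private[OF VV] i by blast
      have "e \<in> ?D" using e(1) e(3)[OF j] i by auto
      then obtain k where k: "k \<in> A" "lookup e k > 0"
        using assoc_at_cover[OF D Au] by (auto simp: cover_def)
      then show "i \<in> A" using e(3)[of k] Au by (cases "k = i") (auto simp: assoc_at_def)
    qed
    then have "A = ?W" using Au by (auto simp: assoc_at_def)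
    then show False using del[of "m + 1" j u] j Au by simp
  qed
  moreover have "beta1 V I \<le> m"
  proof -
    \<comment> \<open>At exponent \<open>m + 1\<close> the maximal ideal is associated, and the
      resulting strict bound \<open>card \<Gamma> < m + 1\<close> is the one sought.\<close>
    have "(var_prime V V :: 'k mpoly set) \<in> Ass (poly_ring V) (mideal V (ksum T (m + 1)))"
      using Ass_high[of "m + 1"] by simp
    then obtain t where t: "assoc_at V (ksum T (m + 1)) V t" by (rule socle_monomial[OF V])
    \<comment> \<open>A socle monomial without \<open>x\<^sub>j\<close> would be one for the deletion at \<open>x\<^sub>j\<close>.\<close>
    have pos: "lookup t j > 0" if j: "j \<in> V" for j
    proof (rule ccontr)
      assume "\<not> lookup t j > 0"
      then have tj: "lookup t j = 0" by simp
      let ?W = "V - {j}" and ?D = "{t \<in> T. lookup t j = 0}"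
      have "t + evar i \<in> multiples (ksum ?D (m + 1))" if i: "i \<in> ?W" for i
      proof -
        obtain g where g: "g \<in> ksum T (m + 1)" "\<And>k. lookup g k \<le> lookup (t + evar i) k"
          using t i by (fastforce simp: assoc_at_def multiples_def)
        \<comment> \<open>As \<open>i \<noteq> j\<close>, the monomial \<open>x^t x_i\<close> still
          lacks \<open>x_j\<close>, so a generator dividing it survives the deletion.\<close>
        then have "lookup g j = 0" using g(2)[of j] i tj by (simp add: lookup_add)
        then have "g \<in> ksum ?D (m + 1)" using g(1) ksum_nolookup[of T "m + 1" j] by blast
        then show ?thesis using g(2) by (rule multiplesI)
      qed
      moreover have "t + r \<notin> multiples (ksum ?D (m + 1))" if r: "keys r \<subseteq> ?W - ?W" for r
      proof
        assume "t + r \<in> multiples (ksum ?D (m + 1))"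
        then have "t + r \<in> multiples (ksum T (m + 1))"
          unfolding ksum_nolookup[symmetric] by (auto simp: multiples_def)
        then show False using t r by (auto simp: assoc_at_def)
      qed
      moreover have "keys t \<subseteq> ?W" using t tj by (auto simp: assoc_at_def in_keys_iff)
      ultimately have "assoc_at ?W (ksum ?D (m + 1)) ?W t" by (simp add: assoc_at_def)
      then show False using del[of "m + 1" j t] j by simp
    qed
    have "card \<Gamma> \<le> m" if "independent_set V I \<Gamma>" for \<Gamma>
      using card_independent_set_less[OF V T _ assoc_at_notin[OF t] pos, of \<Gamma>] that by (simp add: I)
    then have "{card \<Gamma> |\<Gamma>. independent_set V I \<Gamma>} \<subseteq> {..m}" by auto
    \<comment> \<open>\<open>Max\<close> is taken over a finite nonempty set: the bound
      \<open>m\<close> gives finiteness, the empty independent set a member.\<close>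
    moreover have "independent_set V I {}" by (simp add: independent_set_def)
    ultimately show ?thesis unfolding beta1_def
      by (subst Max_le_iff) (auto intro: finite_subset)
  qed
  ultimately show ?thesis by (auto simp: minimally_not_ntf_def V_def)
qed

end
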